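(* Let $G=\langle r_0,\dots,r_{n-1}\rangle$ be a crystallographic linear Coxeter group with string diagram. Suppose that $n\ge3$ and that the prime $p$ is generic for $G$. Let the subspaces $V$, $V_0$, $V_{n-1}$ and $V_{0,n-1}$ be non-singular, and let $G_0^p$ and $G_{n-1}^p$ be of orthogonal type. Suppose as well that there is a square among the labels of the nodes $1,\dots,n-2$ of the diagram $\Delta(G)$. (a) Then $G_0^p\cap G_{n-1}^p$ acts trivially on $V_{0,n-1}^{\perp}$, and $$O_1(V_{0,n-1})\le G_0^p\cap G_{n-1}^p\le O(V_{0,n-1}),$$ where the $(n-2)$-dimensional groups $O(V_{0,n-1})$ and $O_1(V_{0,n-1})$ are identified (by extending isometries by the identity on $V_{0,n-1}^{\perp}$) with the pointwise stabilizers of $V_{0,n-1}^{\perp}$ in the $n$-dimensional groups $O(V)$ and $O_1(V)$, respectively. (b) If $G_0^p=O(V_0)$ and $G_{n-1}^p=O(V_{n-1})$ (with $O(V_0)$, $O(V_{n-1})$ similarly interpreted as the pointwise stabilizers in $O(V)$ of $V_0^\perp$, $V_{n-1}^\perp$), then $$G_0^p\cap G_{n-1}^p=O(V_{0,n-1}).$$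
   Context: Setting. $G=\langle r_0,\dots,r_{n-1}\rangle=[p_1,\dots,p_{n-1}]$ denotes a crystallographic Coxeter group with string Coxeter diagram (nodes $0,\dots,n-1$; the branch joining nodes $i-1$ and $i$ is marked $p_i$; $p_i=2$ means no branch), so each $p_i\in\{2,3,4,6,\infty\}$, in its standard representation as a reflection group on real $n$-space. A basic system is a basis $b_0,\dots,b_{n-1}$ of suitably rescaled simple roots: $b_i\cdot b_i>0$, $b_{i-1}\cdot b_i=-\cos(\pi/p_i)\sqrt{(b_{i-1}\cdot b_{i-1})(b_i\cdot b_i)}$ (with $\cos(\pi/\infty)=1$), $b_i\cdot b_j=0$ for $|i-j|\ge2$, $r_i(x)=x-2\frac{x\cdot b_i}{b_i\cdot b_i}b_i$, and all numbers $2\frac{b_i\cdot b_j}{b_i\cdot b_i}$ are integers. The diagram $\Delta(G)$ is the Coxeter diagram with node $i$ labelled $b_i^2:=b_i\cdot b_i$; the scaling is chosen so that the labels are positive integers with no prime divisors other than $2$ and $3$, and without the prime divisor $3$ on connected components having no branch marked $6$. (Labels may be readjusted by rescaling so that a square occurs among given nodes.) Labels are read modulo $p$, and "square" means square in $\mathbb Z_p=\mathbb Z/p\mathbb Z$. Reduction. For an odd prime $p$, reduce the matrices of the $r_i$ in the basis $(b_i)$ and the Gram matrix $[b_i\cdot b_j]$ modulo $p$. Now $V=\mathbb Z_p^n$ with standard basis $b_0,\dots,b_{n-1}$ and the (possibly singular) symmetric bilinear form $x\cdot y$ given by the reduced Gram matrix; $G^p\le O(V)$ is generated by the reduced $r_i$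 (again denoted $r_i$). The prime $p$ is generic for $G$ if $p\ge5$, or $p=3$ and no branch is marked $6$. For $J\subseteq\{0,\dots,n-1\}$, $G_J^p=\langle r_j\mid j\notin J\rangle$ and $V_J=\mathrm{span}\{b_j\mid j\notin J\}$; $G_0^p$, $V_{0,n-1}$, etc. abbreviate $J=\{0\}$, $J=\{0,n-1\}$, etc. Orthogonal groups. $O(W)$ is the isometry group of a space $W$ with symmetric bilinear form; $W$ is non-singular if $\mathrm{rad}\,W=W\cap W^\perp$ is $\{0\}$. For non-isotropic $a$, $r_a(x)=x-2\frac{x\cdot a}{a\cdot a}a$; its spinor norm is the class of $a\cdot a$ modulo squares. $O_1(W)$ (resp. $O_2(W)$) is the subgroup of $O(W)$ generated by the reflections $r_a$ with $a\cdot a$ a nonzero square (resp. a non-square). For non-singular $W$ of dimension $m$ over $\mathbb Z_p$ one writes $O(m,p,\epsilon)=O(W)$, $O_j(m,p,\epsilon)=O_j(W)$, where $\epsilon=0$ if $m$ is odd, and for $m$ even $\epsilon=1$ or $-1$ according as the Witt index of $W$ is $m/2$ or not. Orthogonal type. $G_j^p$ ($j=0,n-1$), viewed as a group acting on $W=V_j$ (the restriction is faithful here), is of orthogonal type if it equals $O(W)$, $O_1(W)$ or $O_2(W)$, excluding the cases $O_1(3,3,0)$, $O_2(3,5,0)$, $O_2(5,3,0)$ (for these three the form is supposed normalized so that the discriminant of $W$ is a square) and excluding $O_j(4,3,-1)$. *)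

theory Defs
  imports
    "HOL-Analysis.Analysis"
    "HOL-Algebra.Bij"
    "HOL-Algebra.Generated_Groups"
    "HOL-Library.Extended_Nat"
    "HOL-Computational_Algebra.Nth_Powers"
    "Berlekamp_Zassenhaus.Finite_Field"
begin

section \<open>Basic systems of crystallographic string Coxeter groups\<close>

text \<open>
  The rank \<open>n\<close> is \<open>CARD('n)\<close>. The nodes \<open>0, \<dots>, n - 1\<close> of the diagram are the elements of the
  index type, listed by the library enumeration of its universe; node numbers \<open>\<ge> n\<close> are never used.
\<close>

definition node :: "nat \<Rightarrow> 'n::finite" where
  "node = from_nat_into UNIV"

definition reflection :: "('a::field ^ 'n \<Rightarrow> 'a ^ 'n \<Rightarrow> 'a) \<Rightarrow> 'a ^ 'n \<Rightarrow> 'a ^ 'n \<Rightarrow> 'a ^ 'n" where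
  "reflection Q a x = x - (2 * (Q x a / Q a a)) *s a"

definition cos_mark :: "enat \<Rightarrow> real" where
  "cos_mark m = (case m of enat k \<Rightarrow> cos (pi / real k) | \<infinity> \<Rightarrow> 1)"

text \<open>
  \<open>mark i\<close>, for \<open>1 \<le> i < n\<close>, is the mark \<open>p\<^sub>i\<close> of the branch joining nodes \<open>i - 1\<close> and \<open>i\<close>
  (no branch if it is 2). The form \<open>B\<close> may be degenerate or indefinite.
\<close>

definition basic_system ::
  "(real ^ 'n \<Rightarrow> real ^ 'n \<Rightarrow> real) \<Rightarrow> ('n::finite \<Rightarrow> real ^ 'n) \<Rightarrow> (nat \<Rightarrow> enat) \<Rightarrow> bool" where
  "basic_system B b mark \<longleftrightarrow>
     bilinear B \<and> (\<forall>x y. B x y = B y x) \<and>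
     inj b \<and> independent (range b) \<and> span (range b) = UNIV \<and>
     (\<forall>i\<in>{1..<CARD('n)}. mark i \<in> {2, 3, 4, 6, \<infinity>}) \<and>
     (\<forall>i. B (b i) (b i) > 0) \<and>
     (\<forall>i\<in>{1..<CARD('n)}. B (b (node (i - 1))) (b (node i)) =
        - cos_mark (mark i) *
          sqrt (B (b (node (i - 1))) (b (node (i - 1))) * B (b (node i)) (b (node i)))) \<and>
     (\<forall>i<CARD('n). \<forall>j<CARD('n). i + 2 \<le> j \<longrightarrow> B (b (node i)) (b (node j)) = 0) \<and>
     (\<forall>i j. 2 * (B (b i) (b j) / B (b i) (b i)) \<in> \<int>)"

definition joined :: "nat \<Rightarrow> (nat \<Rightarrow> enat) \<Rightarrow> nat \<Rightarrow> nat \<Rightarrow> bool" where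
  "joined n mark i j \<longleftrightarrow>
     i < n \<and> j < n \<and> (j = Suc i \<and> mark j \<noteq> 2 \<or> i = Suc j \<and> mark i \<noteq> 2)"

definition admissible_labels ::
  "(real ^ 'n \<Rightarrow> real ^ 'n \<Rightarrow> real) \<Rightarrow> ('n::finite \<Rightarrow> real ^ 'n) \<Rightarrow> (nat \<Rightarrow> enat) \<Rightarrow> bool" where
  "admissible_labels B b mark \<longleftrightarrow>
     (\<forall>i<CARD('n). \<exists>l::nat. l > 0 \<and> B (b (node i)) (b (node i)) = real l \<and>
        (\<forall>q. prime q \<and> q dvd l \<longrightarrow> q = 2 \<or> q = 3) \<and>
        (3 dvd l \<longrightarrow> (\<exists>k\<in>{1..<CARD('n)}. mark k = 6 \<and> (joined CARD('n) mark)\<^sup>*\<^sup>* i k)))"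

definition generic_prime :: "nat \<Rightarrow> nat \<Rightarrow> (nat \<Rightarrow> enat) \<Rightarrow> bool" where
  "generic_prime p n mark \<longleftrightarrow>
     prime p \<and> (p \<ge> 5 \<or> p = 3 \<and> (\<forall>i\<in>{1..<n}. mark i \<noteq> 6))"


section \<open>Reduction modulo p\<close>

text \<open>
  Reduction of a rational number whose denominator is invertible in \<open>'a\<close>. Fractions are needed
  because Gram matrix entries may be half-integers (e.g. labels 1, 1 joined by a branch marked 3).
\<close>

definition reduce :: "real \<Rightarrow> 'a::field" where
  "reduce x = (THE y. \<exists>c d::int. (of_int d :: 'a) \<noteq> 0 \<and> x = of_int c / of_int d \<and>
                                  y = of_int c / of_int d)"

definition basis_matrix :: "('n::finite \<Rightarrow> real ^ 'n) \<Rightarrow> (real ^ 'n \<Rightarrow> real ^ 'n) \<Rightarrow> real ^ 'n ^ 'n" where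
  "basis_matrix b f = (\<chi> k j. representation (range b) (f (b j)) (b k))"

definition reduced_form ::
  "(real ^ 'n \<Rightarrow> real ^ 'n \<Rightarrow> real) \<Rightarrow> ('n::finite \<Rightarrow> real ^ 'n) \<Rightarrow>
     'a::field ^ 'n \<Rightarrow> 'a ^ 'n \<Rightarrow> 'a" where
  "reduced_form B b x y = (\<Sum>i\<in>UNIV. \<Sum>j\<in>UNIV. x $ i * reduce (B (b i) (b j)) * y $ j)"

definition reduced_reflection ::
  "(real ^ 'n \<Rightarrow> real ^ 'n \<Rightarrow> real) \<Rightarrow> ('n::finite \<Rightarrow> real ^ 'n) \<Rightarrow> 'n \<Rightarrow>
     'a::field ^ 'n \<Rightarrow> 'a ^ 'n" where
  "reduced_reflection B b i =
     (*v) (\<chi> k j. reduce (basis_matrix b (reflection B (b i)) $ k $ j))"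

text \<open>\<open>reduced_group B b J\<close> is \<open>G\<^sub>J\<^sup>p\<close> and \<open>coord_subspace J\<close> is \<open>V\<^sub>J\<close>: the nodes in \<open>J\<close> are left out.\<close>

definition reduced_group ::
  "(real ^ 'n \<Rightarrow> real ^ 'n \<Rightarrow> real) \<Rightarrow> ('n::finite \<Rightarrow> real ^ 'n) \<Rightarrow> 'n set \<Rightarrow>
     ('a::field ^ 'n \<Rightarrow> 'a ^ 'n) set" where
  "reduced_group B b J = generate (BijGroup UNIV) (reduced_reflection B b ` (- J))"

definition coord_subspace :: "'n set \<Rightarrow> ('a::field ^ 'n::finite) set" where
  "coord_subspace J = vec.span ((\<lambda>j. axis j 1) ` (- J))"


section \<open>Orthogonal groups of subspaces\<close>

definition perp :: "('a::field ^ 'n \<Rightarrow> 'a ^ 'n \<Rightarrow> 'a) \<Rightarrow> ('a ^ 'n) set \<Rightarrow> ('a ^ 'n) set" where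
  "perp Q W = {x. \<forall>w\<in>W. Q x w = 0}"

definition nonsingular :: "('a::field ^ 'n \<Rightarrow> 'a ^ 'n \<Rightarrow> 'a) \<Rightarrow> ('a ^ 'n) set \<Rightarrow> bool" where
  "nonsingular Q W \<longleftrightarrow> W \<inter> perp Q W = {0}"

text \<open>
  Isometries of \<open>W\<close> are elements of \<open>BijGroup W\<close>, i.e. bijections of \<open>W\<close> that are
  \<open>undefined\<close> outside \<open>W\<close>.
\<close>

definition orth_group ::
  "('a::field ^ 'n \<Rightarrow> 'a ^ 'n \<Rightarrow> 'a) \<Rightarrow> ('a ^ 'n) set \<Rightarrow> ('a ^ 'n \<Rightarrow> 'a ^ 'n) set" where
  "orth_group Q W =
     {f \<in> Bij W. (\<forall>x\<in>W. \<forall>y\<in>W. f (x + y) = f x + f y) \<and> (\<forall>c. \<forall>x\<in>W. f (c *s x) = c *s f x) \<and>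
                 (\<forall>x\<in>W. \<forall>y\<in>W. Q (f x) (f y) = Q x y)}"

definition orth_group1 ::
  "('a::field ^ 'n \<Rightarrow> 'a ^ 'n \<Rightarrow> 'a) \<Rightarrow> ('a ^ 'n) set \<Rightarrow> ('a ^ 'n \<Rightarrow> 'a ^ 'n) set" where
  "orth_group1 Q W =
     generate (BijGroup W) {restrict (reflection Q a) W | a. a \<in> W \<and> Q a a \<noteq> 0 \<and> is_square (Q a a)}"

definition orth_group2 ::
  "('a::field ^ 'n \<Rightarrow> 'a ^ 'n \<Rightarrow> 'a) \<Rightarrow> ('a ^ 'n) set \<Rightarrow> ('a ^ 'n \<Rightarrow> 'a ^ 'n) set" where
  "orth_group2 Q W =
     generate (BijGroup W) {restrict (reflection Q a) W | a. a \<in> W \<and> \<not> is_square (Q a a)}"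

definition pointwise_stabilizer :: "('v \<Rightarrow> 'v) set \<Rightarrow> 'v set \<Rightarrow> ('v \<Rightarrow> 'v) set" where
  "pointwise_stabilizer K S = {g \<in> K. \<forall>x\<in>S. g x = x}"

text \<open>The isometries of the whole space extending the elements of \<open>K\<close> by the identity on \<open>W\<^sup>\<bottom>\<close>.\<close>

definition extend_by_id ::
  "('a::field ^ 'n \<Rightarrow> 'a ^ 'n \<Rightarrow> 'a) \<Rightarrow> ('a ^ 'n) set \<Rightarrow> ('a ^ 'n \<Rightarrow> 'a ^ 'n) set \<Rightarrow>
     ('a ^ 'n \<Rightarrow> 'a ^ 'n) set" where
  "extend_by_id Q W K = {g \<in> orth_group Q UNIV. restrict g W \<in> K \<and> (\<forall>x\<in>perp Q W. g x = x)}"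

definition witt_index ::
  "('a::field ^ 'n \<Rightarrow> 'a ^ 'n \<Rightarrow> 'a) \<Rightarrow> ('a ^ 'n::finite) set \<Rightarrow> nat" where
  "witt_index Q W =
     Max {vec.dim U | U. vec.subspace U \<and> U \<subseteq> W \<and> (\<forall>x\<in>U. \<forall>y\<in>U. Q x y = 0)}"

definition epsilon ::
  "('a::field ^ 'n \<Rightarrow> 'a ^ 'n \<Rightarrow> 'a) \<Rightarrow> ('a ^ 'n::finite) set \<Rightarrow> int" where
  "epsilon Q W = (if odd (vec.dim W) then 0 else if 2 * witt_index Q W = vec.dim W then 1 else -1)"

text \<open>The Leibniz determinant of the Gram matrix of \<open>w 0, \<dots>, w (m - 1)\<close>.\<close>

definition gram_det ::
  "('a::field ^ 'n \<Rightarrow> 'a ^ 'n \<Rightarrow> 'a) \<Rightarrow> (nat \<Rightarrow> 'a ^ 'n) \<Rightarrow> nat \<Rightarrow> 'a" where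
  "gram_det Q w m =
     (\<Sum>\<pi> | \<pi> permutes {..<m}. of_int (sign \<pi>) * (\<Prod>i<m. Q (w i) (w (\<pi> i))))"

definition square_discriminant ::
  "('a::field ^ 'n \<Rightarrow> 'a ^ 'n \<Rightarrow> 'a) \<Rightarrow> ('a ^ 'n::finite) set \<Rightarrow> bool" where
  "square_discriminant Q W \<longleftrightarrow>
     (\<exists>w. inj_on w {..<vec.dim W} \<and> vec.independent (w ` {..<vec.dim W}) \<and>
          vec.span (w ` {..<vec.dim W}) = W \<and> is_square (gram_det Q w (vec.dim W)))"

text \<open>
  For the three exceptional groups in odd dimension, the form is normalized: it is replaced by a
  scalar multiple with square discriminant. Multiplying by a non-square interchanges
  \<open>orth_group1\<close> and \<open>orth_group2\<close>.
\<close>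

definition excluded_type ::
  "('p::prime_card mod_ring ^ 'n \<Rightarrow> 'p mod_ring ^ 'n \<Rightarrow> 'p mod_ring) \<Rightarrow>
     ('p mod_ring ^ 'n::finite) set \<Rightarrow> ('p mod_ring ^ 'n \<Rightarrow> 'p mod_ring ^ 'n) set \<Rightarrow> bool" where
  "excluded_type Q W H \<longleftrightarrow>
     (\<exists>c. c \<noteq> 0 \<and> square_discriminant (\<lambda>x y. c * Q x y) W \<and>
        (vec.dim W = 3 \<and> CARD('p) = 3 \<and> H = orth_group1 (\<lambda>x y. c * Q x y) W \<or>
         vec.dim W = 3 \<and> CARD('p) = 5 \<and> H = orth_group2 (\<lambda>x y. c * Q x y) W \<or>
         vec.dim W = 5 \<and> CARD('p) = 3 \<and> H = orth_group2 (\<lambda>x y. c * Q x y) W)) \<or>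
     vec.dim W = 4 \<and> CARD('p) = 3 \<and> epsilon Q W = -1 \<and> (H = orth_group1 Q W \<or> H = orth_group2 Q W)"

text \<open>\<open>K\<close> acts on the whole space and leaves \<open>W\<close> invariant; the type refers to its action on \<open>W\<close>.\<close>

definition orthogonal_type ::
  "('p::prime_card mod_ring ^ 'n \<Rightarrow> 'p mod_ring ^ 'n \<Rightarrow> 'p mod_ring) \<Rightarrow>
     ('p mod_ring ^ 'n::finite) set \<Rightarrow> ('p mod_ring ^ 'n \<Rightarrow> 'p mod_ring ^ 'n) set \<Rightarrow> bool" where
  "orthogonal_type Q W K \<longleftrightarrow>
     (let H = (\<lambda>g. restrict g W) ` K
      in (H = orth_group Q W \<or> H = orth_group1 Q W \<or> H = orth_group2 Q W) \<and>
         \<not> excluded_type Q W H)"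

end

theory Submission
  imports Defs
begin

text \<open>
  Write \<open>U\<close> for \<open>V0n\<close>, and \<open>W\<close> for one of \<open>V0\<close> and \<open>Vn\<close>. Over a field of odd characteristic a nonsingular
  subspace splits off with its orthogonal complement, so isometries that fix \<open>U\<^sup>\<bottom>\<close> are the same as
  isometries of \<open>U\<close>; this gives the identifications in the statement. An element of both groups
  preserves \<open>U = V0 \<inter> Vn\<close> and moves every vector by an element of \<open>U\<close>, hence it fixes \<open>U\<^sup>\<bottom>\<close>
  (\<open>common_element_fixes_perp\<close>).
  
  The substance is that every \<open>g\<close> in \<open>O\<^sub>1(V)\<close> fixing \<open>U\<^sup>\<bottom>\<close> lies in the group on \<open>W\<close>
  (\<open>stabilizer_in_orthogonal_type\<close>). If this group is \<open>O(W)\<close>, that is clear. It is not \<open>O\<^sub>2(W)\<close>,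
  because it contains the reflection of square norm at an inner node, and the spinor norm, combined
  with the determinant, separates the two kinds of reflections. The case \<open>O\<^sub>1(W)\<close> remains. By Cartan
  and Dieudonne \<open>g\<close> is a product of reflections in vectors of \<open>U\<close>, and by the spinor norm an even
  number of them have nonsquare norm. So it suffices to write a product \<open>r\<^sub>a r\<^sub>b\<close> of two nonsquare
  reflections, \<open>a, b \<in> U\<close>, as a product of square reflections in \<open>W\<close>.
  
  In place of the spinor norm, a transfer homomorphism is used: the sign with which an isometry
  permutes the pairs \<open>{v, - v}\<close> of vectors of a given norm (\<open>transfer_reflection\<close>).
  
  If \<open>a\<close> and \<open>b\<close> span a nonsingular plane, this plane contains a vector \<open>c\<close> of norm 1, and
  \<open>r\<^sub>a r\<^sub>b = r\<^sub>c r\<^sub>d\<close> with \<open>d\<close> of square norm (\<open>three_reflections_in_plane\<close>). If they span a singular plane,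
  one inserts \<open>r\<^sub>f r\<^sub>f\<close> for a suitable third vector \<open>f\<close>. It exists for \<open>p \<ge> 5\<close>
  (\<open>nonsquare_pair_char_ge_5\<close>), and for \<open>p = 3\<close> if \<open>W\<close> has dimension at least five
  (\<open>nonsquare_pair_F3\<close>). For \<open>p = 3\<close> a singular plane of this kind does not fit into \<open>U\<close> if \<open>W\<close> has
  dimension at most three. In dimension four its presence forces the four simple roots in \<open>W\<close> to be
  orthogonal unit vectors modulo 3; they generate a group that fixes the simple roots up to sign
  and is therefore smaller than \<open>O\<^sub>1(W)\<close> (\<open>rank_4_not_all_square_reflections\<close>).
\<close>

section \<open>Squares in finite fields of odd characteristic\<close>

text \<open>
  Squaring is at most two-to-one on the nonzero elements, so at least half of them are squares;
  zero is one more square.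
\<close>

lemma card_squares_ge:
  assumes "(2 :: 'a :: {field, finite}) \<noteq> 0"
  shows "CARD('a) + 1 \<le> 2 * card {x::'a. is_square x}"
proof -
  let ?S = "{s::'a. s \<noteq> 0 \<and> is_square s}"
  have *: "card {x::'a. x^2 = s} \<le> 2" for s
  proof (cases "\<exists>y. y^2 = s")
    case True
    then obtain y where "y^2 = s" by auto
    then have "{x::'a. x^2 = s} \<subseteq> {y, -y}" by (auto simp: power2_eq_iff)
    then have "card {x::'a. x^2 = s} \<le> card {y, -y}" by (intro card_mono) auto
    also have "\<dots> \<le> 2" by (simp add: card_insert_if)
    finally show ?thesis .
  qed auto
  have "UNIV - {0::'a} = (\<Union>s\<in>?S. {x. x^2 = s})"
    by (auto simp: is_nth_power_def)
  then have "CARD('a) - 1 = card (\<Union>s\<in>?S. {x::'a. x^2 = s})"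
    by (metis card_Diff_singleton finite_class.finite_UNIV iso_tuple_UNIV_I)
  also have "\<dots> \<le> (\<Sum>s\<in>?S. card {x::'a. x^2 = s})" by (rule card_UN_le) simp
  also have "\<dots> \<le> card ?S * 2" using sum_bounded_above[of ?S "\<lambda>s. card {x::'a. x^2 = s}" 2] * by simp
  finally have "CARD('a) - 1 \<le> 2 * card ?S" by simp
  moreover have "{x::'a. is_square x} = insert 0 ?S" by auto
  then have "card {x::'a. is_square x} = Suc (card ?S)" by simp
  moreover have "CARD('a) \<ge> 1" by (simp add: Suc_le_eq)
  ultimately show ?thesis by linarith
qed

lemma is_square_mult: "is_square (x::'a::comm_monoid_mult) \<Longrightarrow> is_square y \<Longrightarrow> is_square (x * y)"
  unfolding is_nth_power_def by (metis power_mult_distrib)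

lemma is_square_cancel:
  assumes "is_square (c * s)" "is_square s" "(s::'a::field) \<noteq> 0"
  shows "is_square c"
proof -
  obtain y z where "s = y^2" "c * s = z^2" using assms by (auto simp: is_nth_power_def)
  with \<open>s \<noteq> 0\<close> have "c = (z / y)^2" by (auto simp: power_divide field_simps)
  then show ?thesis by auto
qed

text \<open>
  Multiplication by a nonsquare maps the nonzero squares into the nonsquares. There are no more
  nonsquares than nonzero squares, so it reaches all of them, and two nonsquares differ by a
  square factor.
\<close>

lemma nonsquare_mult_nonsquare:
  fixes a b :: "'a :: {field, finite}"
  assumes "(2::'a) \<noteq> 0" "\<not> is_square a" "\<not> is_square b"
  shows "is_square (a * b)"
proof -
  let ?S = "{x::'a. is_square x}"
  let ?N = "{x::'a. \<not> is_square x}"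
  have sub: "(*) c ` (?S - {0}) \<subseteq> ?N" if "\<not> is_square c" for c :: 'a
    using that is_square_cancel by blast
  have N: "card ?N + card ?S = CARD('a)"
    by (subst card_Un_disjoint[symmetric]) (auto intro!: arg_cong[where f=card])
  have "(*) c ` (?S - {0}) = ?N" if "\<not> is_square c" for c :: 'a
  proof (rule card_subset_eq[OF _ sub[OF that]])
    have "c \<noteq> 0" using that by auto
    then have "card ((*) c ` (?S - {0})) = card ?S - 1"
      by (subst card_image) (auto simp: inj_on_def card_Diff_singleton)
    moreover have "card ?S - 1 \<ge> card ?N" using card_squares_ge[OF assms(1)] N by linarith
    ultimately show "card ((*) c ` (?S - {0})) = card ?N"
      using card_mono[OF _ sub[OF that]] by simp
  qed simp
  then have "a \<in> (*) b ` (?S - {0})" using assms by blast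
  then obtain s where "is_square s" "a = b * s" by auto
  then have "a * b = b^2 * s" by (simp add: power2_eq_square)
  then show ?thesis using \<open>is_square s\<close> by (auto intro: is_square_mult)
qed

text \<open>
  The \<open>q\<close> elements of the field cannot accommodate the two sets \<open>{a * x\<^sup>2}\<close> and \<open>{c - b * y\<^sup>2}\<close>
  disjointly, since each has at least \<open>(q + 1) / 2\<close> elements.
\<close>

lemma binary_form_universal:
  fixes a b c :: "'a :: {field, finite}"
  assumes "(2::'a) \<noteq> 0" "a \<noteq> 0" "b \<noteq> 0"
  shows "\<exists>x y. a * x^2 + b * y^2 = c"
proof -
  let ?S = "{x::'a. is_square x}"
  let ?A = "(*) a ` ?S" and ?B = "(\<lambda>s. c - b * s) ` ?S"
  have cards: "card ?A = card ?S" "card ?B = card ?S"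
    using assms by (auto intro!: card_image inj_onI)
  have "?A \<inter> ?B \<noteq> {}"
  proof
    assume "?A \<inter> ?B = {}"
    then have "card (?A \<union> ?B) = card ?S + card ?S" using cards by (simp add: card_Un_disjoint)
    moreover have "card (?A \<union> ?B) \<le> CARD('a)" by (simp add: card_mono)
    ultimately show False using card_squares_ge[OF assms(1)] by linarith
  qed
  then obtain s t where "is_square s" "is_square t" "a * s = c - b * t" by auto
  then show ?thesis by (auto simp: is_nth_power_def algebra_simps eq_diff_eq)
qed

section \<open>An involution and an identity of coefficients\<close>

lemma even_card_involution:
  assumes "finite X" "\<And>x. x \<in> X \<Longrightarrow> h x \<in> X" "\<And>x. x \<in> X \<Longrightarrow> h (h x) = x" "\<And>x. x \<in> X \<Longrightarrow> h x \<noteq> x"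
  shows "even (card X)"
  using assms
proof (induction "card X" arbitrary: X rule: less_induct)
  case less
  show ?case
  proof (cases "X = {}")
    case False
    then obtain x where x: "x \<in> X" by auto
    let ?Y = "X - {x, h x}"
    have sub: "{x, h x} \<subseteq> X" using x less.prems(2) by auto
    have "card {x, h x} = 2" using less.prems(4)[OF x] by auto
    then have c: "card X = card ?Y + 2"
      using card_Diff_subset[of "{x, h x}" X] card_mono[OF less.prems(1) sub] sub by simp
    have "even (card ?Y)"
    proof (rule less.hyps)
      show "h y \<in> ?Y" if "y \<in> ?Y" for y
        using that less.prems(2,3) x by (metis DiffD1 DiffD2 DiffI insertCI insertE singletonD)
    qed (use c less.prems in auto)
    then show ?thesis using c by simp
  qed simp
qed

text \<open>
  The comparison of the coefficients of \<open>a\<close> and \<open>b\<close> in \<open>three_reflections_in_plane\<close>, where \<open>\<alpha> = a \<cdot> a\<close>, \<open>\<beta> = b \<cdot> b\<close>,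
  \<open>\<gamma> = a \<cdot> b\<close>, \<open>C = c \<cdot> c\<close>, \<open>s = v \<cdot> a\<close>, \<open>t = v \<cdot> b\<close> and \<open>T = v \<cdot> d\<close>.
\<close>

lemma three_reflections_coefficients:
  fixes \<alpha> \<beta> \<gamma> x y s t C :: "'a::field"
  assumes nz: "\<alpha> \<noteq> 0" "\<beta> \<noteq> 0" "C \<noteq> 0" and C: "C = x^2 * \<alpha> + 2 * x * y * \<gamma> + y^2 * \<beta>"
  defines "A \<equiv> 2 * ((s - 2 * (t / \<beta>) * \<gamma>) / \<alpha>)"
  defines "N \<equiv> x * (s - 2 * (t / \<beta>) * \<gamma> - A * \<alpha>) + y * (t - 2 * (t / \<beta>) * \<beta> - A * \<gamma>)"
  defines "T \<equiv> (x * \<alpha> + 2 * y * \<gamma>) * t - y * \<beta> * s"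
  shows "A + 2 * (N / C) * x = - (2 * (T / (C * \<alpha> * \<beta>)) * (y * \<beta>))"
    and "2 * (t / \<beta>) + 2 * (N / C) * y = 2 * (T / (C * \<alpha> * \<beta>)) * (x * \<alpha> + 2 * y * \<gamma>)"
proof -
  have nzz: "C * \<alpha> * \<beta> \<noteq> 0" using nz by simp
  have A: "A * (\<alpha> * \<beta>) = 2 * (s * \<beta> - 2 * t * \<gamma>)" using nz by (simp add: A_def field_simps)
  have B: "2 * (t / \<beta>) * (\<alpha> * \<beta>) = 2 * t * \<alpha>" using nz by simp
  have "N * (\<alpha> * \<beta>) = x * (s * (\<alpha> * \<beta>) - (2 * (t / \<beta>) * (\<alpha> * \<beta>)) * \<gamma> - (A * (\<alpha> * \<beta>)) * \<alpha>) +
      y * (t * (\<alpha> * \<beta>) - (2 * (t / \<beta>) * (\<alpha> * \<beta>)) * \<beta> - (A * (\<alpha> * \<beta>)) * \<gamma>)"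
    unfolding N_def by (simp only: ring_distribs mult_ac)
  then have N: "N * (\<alpha> * \<beta>) = x * (s * (\<alpha> * \<beta>) - 2 * t * \<alpha> * \<gamma> - 2 * (s * \<beta> - 2 * t * \<gamma>) * \<alpha>) +
      y * (t * (\<alpha> * \<beta>) - 2 * t * \<alpha> * \<beta> - 2 * (s * \<beta> - 2 * t * \<gamma>) * \<gamma>)"
    by (simp only: A B)
  have "(A + 2 * (N / C) * x) * (C * \<alpha> * \<beta>) = (A * (\<alpha> * \<beta>)) * C + 2 * (N * (\<alpha> * \<beta>)) * x"
    using nz by (simp add: field_simps)
  also have "\<dots> = - (2 * T * (y * \<beta>))"
    unfolding A N C T_def by (simp add: power2_eq_square algebra_simps)
  also have "\<dots> = - (2 * (T / (C * \<alpha> * \<beta>)) * (y * \<beta>)) * (C * \<alpha> * \<beta>)"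
    using nz by (simp add: field_simps)
  finally show "A + 2 * (N / C) * x = - (2 * (T / (C * \<alpha> * \<beta>)) * (y * \<beta>))" by (simp only: mult_right_cancel[OF nzz])
  have "(2 * (t / \<beta>) + 2 * (N / C) * y) * (C * \<alpha> * \<beta>) = 2 * t * \<alpha> * C + 2 * (N * (\<alpha> * \<beta>)) * y"
    using nz by (simp add: field_simps)
  also have "\<dots> = 2 * T * (x * \<alpha> + 2 * y * \<gamma>)"
    unfolding N C T_def by (simp add: power2_eq_square algebra_simps)
  also have "\<dots> = 2 * (T / (C * \<alpha> * \<beta>)) * (x * \<alpha> + 2 * y * \<gamma>) * (C * \<alpha> * \<beta>)"
    using nz by (simp add: field_simps)
  finally show "2 * (t / \<beta>) + 2 * (N / C) * y = 2 * (T / (C * \<alpha> * \<beta>)) * (x * \<alpha> + 2 * y * \<gamma>)"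
    by (simp only: mult_right_cancel[OF nzz])
qed

section \<open>Reflections and isometries\<close>

text \<open>
  As reflections are involutions, this monoid is the group generated by the reflections in the
  vectors of \<open>A\<close>. All maps live on the whole space: a group acting on a nonsingular subspace is
  handled through its extension by the identity on the orthogonal complement, so that groups on
  different subspaces can be compared directly.
\<close>

inductive_set refl_products ::
  "('a::field ^ 'n \<Rightarrow> 'a ^ 'n \<Rightarrow> 'a) \<Rightarrow> ('a ^ 'n) set \<Rightarrow> ('a ^ 'n \<Rightarrow> 'a ^ 'n) set"
  for Q A where
    id: "id \<in> refl_products Q A"
  | step: "a \<in> A \<Longrightarrow> g \<in> refl_products Q A \<Longrightarrow> reflection Q a \<circ> g \<in> refl_products Q A"

lemma reflection_in_refl_products: "a \<in> A \<Longrightarrow> reflection Q a \<in> refl_products Q A"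
  using refl_products.step[OF _ refl_products.id] by fastforce

lemma refl_products_comp:
  "g \<in> refl_products Q A \<Longrightarrow> h \<in> refl_products Q A \<Longrightarrow> g \<circ> h \<in> refl_products Q A"
  by (induction rule: refl_products.induct) (auto intro: refl_products.step simp: comp_assoc)

lemma refl_products_mono: "A \<subseteq> A' \<Longrightarrow> refl_products Q A \<subseteq> refl_products Q A'"
proof
  fix g assume "A \<subseteq> A'" "g \<in> refl_products Q A"
  from this(2,1) show "g \<in> refl_products Q A'"
    by (induction rule: refl_products.induct) (auto intro: refl_products.intros)
qed

text \<open>
  Finiteness of the field is essential in two places: nonsingular binary forms represent every
  value, and the transfer is a product over a finite set of vectors.
\<close>

locale quadratic_space =
  fixes Q :: "'a::{field,finite} ^ 'n::finite \<Rightarrow> 'a ^ 'n \<Rightarrow> 'a"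
  assumes add_left: "Q (x + y) z = Q x z + Q y z"
    and scale_left: "Q (c *s x) z = c * Q x z"
    and sym: "Q x y = Q y x"
    and two_nonzero: "(2::'a) \<noteq> 0"
    and nondegenerate: "nonsingular Q UNIV"
begin

lemma add_right: "Q z (x + y) = Q z x + Q z y"
  by (metis add_left sym)

lemma scale_right: "Q z (c *s x) = c * Q z x"
  by (metis scale_left sym)

lemma zero_left [simp]: "Q 0 z = 0"
  using scale_left[of 0 0 z] by simp

lemma zero_right [simp]: "Q z 0 = 0"
  using sym zero_left by metis

lemma minus_left [simp]: "Q (- x) z = - Q x z"
  using scale_left[of "-1" x z] by simp

lemma minus_right [simp]: "Q z (- x) = - Q z x"
  using sym minus_left by metis

lemma diff_left: "Q (x - y) z = Q x z - Q y z"
  using add_left[of x "-y" z] by simp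

lemma diff_right: "Q z (x - y) = Q z x - Q z y"
  using sym diff_left by metis

lemmas bilin = add_left add_right scale_left scale_right diff_left diff_right

lemma eq_zeroI: "(\<And>y. Q x y = 0) \<Longrightarrow> x = 0"
  using nondegenerate by (auto simp: nonsingular_def perp_def)

lemma nonsingularD: "nonsingular Q W \<Longrightarrow> x \<in> W \<Longrightarrow> (\<And>w. w \<in> W \<Longrightarrow> Q x w = 0) \<Longrightarrow> x = 0"
  by (auto simp: nonsingular_def perp_def)

lemma nonsingularI:
  "vec.subspace W \<Longrightarrow> (\<And>x. x \<in> W \<Longrightarrow> (\<And>w. w \<in> W \<Longrightarrow> Q x w = 0) \<Longrightarrow> x = 0) \<Longrightarrow> nonsingular Q W"
  by (auto simp: nonsingular_def perp_def vec.subspace_0)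

definition isometry :: "('a ^ 'n \<Rightarrow> 'a ^ 'n) \<Rightarrow> bool" where
  "isometry g \<longleftrightarrow> (\<forall>x y. g (x + y) = g x + g y) \<and> (\<forall>c x. g (c *s x) = c *s g x) \<and>
     (\<forall>x y. Q (g x) (g y) = Q x y)"

lemma isometryD:
  assumes "isometry g"
  shows "g (x + y) = g x + g y" "g (c *s x) = c *s g x" "Q (g x) (g y) = Q x y"
    "g 0 = 0" "g (- x) = - g x" "g (x - y) = g x - g y"
proof -
  show *: "g (x + y) = g x + g y" "g (c *s x) = c *s g x" "Q (g x) (g y) = Q x y" for x y c
    using assms by (auto simp: isometry_def)
  show "g 0 = 0" using *(2)[of 0 0] by simp
  show **: "g (- x) = - g x" for x using *(2)[of "-1" x] by simp
  show "g (x - y) = g x - g y" using *(1)[of x "-y"] **[of y] by simp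
qed

lemma isometry_inj: "isometry g \<Longrightarrow> inj g"
proof (rule injI)
  fix x y assume g: "isometry g" and "g x = g y"
  then have "g (x - y) = 0" by (simp add: isometryD)
  have "Q (x - y) z = 0" for z
    using isometryD(3)[OF g, of "x - y" z] \<open>g (x - y) = 0\<close> by simp
  then have "x - y = 0" by (rule eq_zeroI)
  then show "x = y" by simp
qed

lemma orth_group_UNIV: "orth_group Q UNIV = {g. isometry g}"
proof -
  have "g \<in> Bij UNIV" if "isometry g" for g
    using isometry_inj[OF that] by (simp add: Bij_def bij_betw_def finite_UNIV_inj_surj)
  then show ?thesis by (auto simp: orth_group_def isometry_def)
qed

lemma isometry_id: "isometry id"
  by (auto simp: isometry_def)

lemma isometry_comp: "isometry g \<Longrightarrow> isometry h \<Longrightarrow> isometry (g \<circ> h)"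
  by (auto simp: isometry_def)

lemma reflection_orth: "Q a a \<noteq> 0 \<Longrightarrow> Q (reflection Q a x) a = - Q x a"
  by (simp add: reflection_def bilin)

text \<open>
  Division by zero makes the reflection in an isotropic vector the identity, so several facts
  about reflections need no hypothesis on the norm of the vector.
\<close>

lemma reflection_isotropic: "Q a a = 0 \<Longrightarrow> reflection Q a x = x"
  by (simp add: reflection_def)

lemma reflection_reflection [simp]: "reflection Q a (reflection Q a x) = x"
proof (cases "Q a a = 0")
  case False
  define y where "y = reflection Q a x"
  have "Q y a = - Q x a" unfolding y_def using False by (rule reflection_orth)
  then have "reflection Q a y = y + (2 * (Q x a / Q a a)) *s a"
    by (simp add: reflection_def)
  then show ?thesis by (simp add: y_def reflection_def)
qed (simp add: reflection_isotropic)

lemma reflection_comp_self [simp]: "reflection Q a \<circ> reflection Q a = id"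
  "reflection Q a \<circ> (reflection Q a \<circ> g) = g"
  by auto

lemma isometry_reflection: "isometry (reflection Q a)"
proof (cases "Q a a = 0")
  case True
  then show ?thesis by (simp add: reflection_isotropic isometry_def)
next
  case False
  have "Q (reflection Q a x) (reflection Q a y) = Q x y" for x y
    using False by (simp add: reflection_def bilin sym[of a y])
  moreover have "reflection Q a (x + y) = reflection Q a x + reflection Q a y" for x y
    by (simp add: reflection_def bilin add_divide_distrib distrib_left vec.scale_left_distrib)
  moreover have "reflection Q a (c *s x) = c *s reflection Q a x" for c x
    by (simp add: reflection_def bilin vec.scale_right_diff_distrib mult.left_commute)
  ultimately show ?thesis by (simp add: isometry_def)
qed

lemma reflection_fixes: "Q x a = 0 \<Longrightarrow> reflection Q a x = x"
  by (simp add: reflection_def)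

lemma reflection_self: "Q a a \<noteq> 0 \<Longrightarrow> reflection Q a a = - a"
  by (simp add: reflection_def vec_eq_iff)

lemma reflection_in_subspace:
  "vec.subspace W \<Longrightarrow> a \<in> W \<Longrightarrow> x \<in> W \<Longrightarrow> reflection Q a x \<in> W"
  unfolding reflection_def by (intro vec.subspace_diff vec.subspace_scale)

lemma conjugate_reflection: "isometry g \<Longrightarrow> g (reflection Q a x) = reflection Q (g a) (g x)"
  by (simp add: reflection_def isometryD)

lemma isometry_refl_products: "g \<in> refl_products Q A \<Longrightarrow> isometry g"
  by (induction rule: refl_products.induct)
     (simp_all only: isometry_id isometry_comp isometry_reflection)

lemma refl_products_fixes:
  "g \<in> refl_products Q A \<Longrightarrow> A \<subseteq> W \<Longrightarrow> x \<in> perp Q W \<Longrightarrow> g x = x"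
  by (induction rule: refl_products.induct) (auto simp: perp_def reflection_fixes)

lemma refl_products_displacement:
  assumes "g \<in> refl_products Q A" "A \<subseteq> W" "vec.subspace W"
  shows "g x - x \<in> W"
  using assms
proof (induction rule: refl_products.induct)
  case (step a g)
  have "reflection Q a (g x) - x = (g x - x) - (2 * (Q (g x) a / Q a a)) *s a"
    by (simp add: reflection_def)
  also have "\<dots> \<in> W"
    using step by (intro vec.subspace_diff[of W "g x - x"] vec.subspace_scale) auto
  finally show ?case by simp
qed (simp add: vec.subspace_0)

lemma refl_products_in_subspace:
  assumes "g \<in> refl_products Q A" "A \<subseteq> W" "vec.subspace W" "x \<in> W"
  shows "g x \<in> W"
  using vec.subspace_add[OF assms(3) refl_products_displacement[OF assms(1-3)] assms(4), of x] by simp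

lemma reflection_scale: "k \<noteq> 0 \<Longrightarrow> reflection Q (k *s a) = reflection Q a"
  by (rule ext) (simp add: reflection_def bilin)


section \<open>The spinor norm as a transfer\<close>

text \<open>
  The group of isometries permutes the pairs \<open>{v, - v}\<close> of vectors of norm \<open>c \<noteq> 0\<close>. After one vector
  has been marked in each pair, an isometry sends marked vectors to vectors that are marked up to
  sign, and the product of these signs is a homomorphism to \<open>{1, - 1}\<close>: the transfer of the sign
  character of \<open>{1, - 1}\<close>. On a reflection \<open>r\<^sub>a\<close> it detects whether \<open>a\<close> has a multiple of norm \<open>c\<close>,
  that is, the class of \<open>a \<cdot> a\<close> modulo squares. The transfers for a square \<open>c\<close> and for a nonsquare \<open>c\<close>
  together carry the same information as the spinor norm and the determinant.
\<close>

text \<open>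
  The choice depends only on the set \<open>{v, - v}\<close>, so it marks exactly one vector of each pair
  (\<open>pm_sign_minus\<close>).
\<close>

definition pm_sign :: "'a ^ 'n \<Rightarrow> int" where
  "pm_sign v = (if v = (SOME x. x = v \<or> x = - v) then 1 else - 1)"

definition half_sphere :: "'a \<Rightarrow> ('a ^ 'n) set" where
  "half_sphere c = {v. Q v v = c \<and> pm_sign v = 1}"

definition transfer :: "'a \<Rightarrow> ('a ^ 'n \<Rightarrow> 'a ^ 'n) \<Rightarrow> int" where
  "transfer c g = (\<Prod>v\<in>half_sphere c. pm_sign (g v))"

definition pm_rep :: "'a ^ 'n \<Rightarrow> 'a ^ 'n" where
  "pm_rep v = (if pm_sign v = 1 then v else - v)"

lemma neq_minus: "(v :: 'a ^ 'n) \<noteq> 0 \<Longrightarrow> v \<noteq> - v"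
proof
  assume "v \<noteq> 0" and eq: "v = - v"
  have "v $ i = 0" for i
  proof -
    have "v $ i = - v $ i" using arg_cong[OF eq, of "\<lambda>v. v $ i"] by simp
    then have "2 * v $ i = 0" unfolding mult_2 by (simp only: eq_neg_iff_add_eq_0)
    then show ?thesis using two_nonzero by simp
  qed
  with \<open>v \<noteq> 0\<close> show False by (simp add: vec_eq_iff)
qed

lemma pm_sign_minus:
  assumes "v \<noteq> 0"
  shows "pm_sign (- v) = - pm_sign v"
proof -
  have "(\<lambda>x. x = - v \<or> x = - (- v)) = (\<lambda>x. x = v \<or> x = - v)" by auto
  then have e: "(SOME x. x = - v \<or> x = - (- v)) = (SOME x. x = v \<or> x = - v)" by simp
  have "(SOME x. x = v \<or> x = - v) = v \<or> (SOME x. x = v \<or> x = - v) = - v"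
    by (rule someI_ex) auto
  then show ?thesis
    unfolding pm_sign_def e using neq_minus[OF assms] by auto
qed

lemma pm_sign_cases: "pm_sign v = 1 \<or> pm_sign v = - 1"
  by (simp add: pm_sign_def)

lemma half_sphere_nonzero: "c \<noteq> 0 \<Longrightarrow> v \<in> half_sphere c \<Longrightarrow> v \<noteq> 0"
  by (auto simp: half_sphere_def)

lemma pm_rep_in_half_sphere:
  assumes "c \<noteq> 0" "Q v v = c"
  shows "pm_rep v \<in> half_sphere c"
proof -
  have "v \<noteq> 0" using assms by auto
  then have "pm_sign (- v) = - pm_sign v" by (rule pm_sign_minus)
  with pm_sign_cases[of v] show ?thesis
    using assms(2) by (auto simp: pm_rep_def half_sphere_def)
qed

lemma half_sphere_pm:
  assumes "c \<noteq> 0" "v \<in> half_sphere c" "w \<in> half_sphere c" "v = w \<or> v = - w"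
  shows "v = w"
proof (rule ccontr)
  assume "v \<noteq> w"
  then have "pm_sign v = - pm_sign w"
    using assms(4) pm_sign_minus[OF half_sphere_nonzero[OF assms(1,3)]] by simp
  with assms(2,3) show False by (simp add: half_sphere_def)
qed

lemma pm_sign_rep:
  assumes "isometry g" "v \<noteq> 0"
  shows "pm_sign (g v) = pm_sign v * pm_sign (g (pm_rep v))"
proof -
  have "g v \<noteq> 0" using assms isometry_inj[of g] isometryD(4)[of g] by (metis injD)
  then have "pm_sign (- g v) = - pm_sign (g v)" by (rule pm_sign_minus)
  with pm_sign_cases[of v] show ?thesis
    by (auto simp: pm_rep_def isometryD(5)[OF assms(1)])
qed

text \<open>
  An isometry permutes the pairs, hence their marked vectors.
\<close>

lemma pm_rep_isometry_bij:
  assumes "c \<noteq> 0" "isometry g"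
  shows "bij_betw (\<lambda>v. pm_rep (g v)) (half_sphere c) (half_sphere c)"
proof -
  let ?f = "\<lambda>v. pm_rep (g v)"
  have into: "?f ` half_sphere c \<subseteq> half_sphere c"
    using assms by (auto intro!: pm_rep_in_half_sphere simp: isometryD) (auto simp: half_sphere_def)
  have inj: "inj_on ?f (half_sphere c)"
  proof (rule inj_onI)
    fix v w assume v: "v \<in> half_sphere c" "w \<in> half_sphere c" "?f v = ?f w"
    then have "g v = g w \<or> g v = g (- w)"
      unfolding isometryD(5)[OF assms(2), of w] by (auto simp: pm_rep_def minus_equation_iff[of "g v"] split: if_splits)
    then have "v = w \<or> v = - w" using isometry_inj[OF assms(2)] by (auto dest: injD)
    then show "v = w" using half_sphere_pm[OF assms(1) v(1,2)] by simp
  qed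
  show ?thesis
    using endo_inj_surj[OF _ into inj] inj by (simp add: bij_betw_def)
qed

text \<open>
  The sign that \<open>g \<circ> h\<close> attaches to a marked vector \<open>v\<close> is the sign of \<open>h v\<close> times the sign that \<open>g\<close>
  attaches to the marked vector of the pair of \<open>h v\<close>; as \<open>v\<close> varies, the latter runs over all
  marked vectors.
\<close>

lemma transfer_comp:
  assumes "c \<noteq> 0" "isometry g" "isometry h"
  shows "transfer c (g \<circ> h) = transfer c g * transfer c h"
proof -
  have "transfer c (g \<circ> h) = (\<Prod>v\<in>half_sphere c. pm_sign (h v) * pm_sign (g (pm_rep (h v))))"
    unfolding transfer_def
  proof (rule prod.cong)
    fix v assume "v \<in> half_sphere c"
    then have "Q (h v) (h v) = c" using assms by (simp add: isometryD half_sphere_def)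
    then have "h v \<noteq> 0" using assms(1) by auto
    then show "pm_sign ((g \<circ> h) v) = pm_sign (h v) * pm_sign (g (pm_rep (h v)))"
      using pm_sign_rep[OF assms(2)] by simp
  qed simp
  also have "\<dots> = transfer c h * (\<Prod>v\<in>half_sphere c. pm_sign (g (pm_rep (h v))))"
    by (simp add: prod.distrib transfer_def)
  also have "(\<Prod>v\<in>half_sphere c. pm_sign (g (pm_rep (h v)))) = transfer c g"
    unfolding transfer_def by (rule prod.reindex_bij_betw[OF pm_rep_isometry_bij]) (use assms in auto)
  finally show ?thesis by (simp only: mult.commute)
qed

lemma transfer_id [simp]: "transfer c id = 1"
  by (auto simp: transfer_def half_sphere_def intro: prod.neutral)

text \<open>
  If \<open>r\<^sub>a\<close> interchanges two pairs, both contribute the same sign. If it fixes a pair, then either it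
  fixes both vectors, or it negates them and they are multiples of \<open>a\<close>. So the product is \<open>- 1\<close>
  exactly if the line of \<open>a\<close> contains vectors of norm \<open>c\<close>.
\<close>

lemma transfer_reflection:
  assumes "c \<noteq> 0" "Q a a \<noteq> 0"
  shows "transfer c (reflection Q a) = (if is_square (c * Q a a) then - 1 else 1)"
proof -
  let ?r = "reflection Q a"
  let ?f = "\<lambda>v. pm_rep (?r v)"
  let ?N = "{v \<in> half_sphere c. pm_sign (?r v) = - 1}"
  let ?F = "{v \<in> half_sphere c. ?r v = - v}"
  have nz: "v \<noteq> 0" if "v \<in> half_sphere c" for v
    using that half_sphere_nonzero[OF assms(1) that] by simp
  have "transfer c ?r = (\<Prod>v\<in>half_sphere c. if pm_sign (?r v) = - 1 then - 1 else 1)"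
    unfolding transfer_def by (rule prod.cong) (use pm_sign_cases in force)+
  also have "\<dots> = (- 1) ^ card ?N"
    by (simp add: prod.If_cases Int_def)
  \<comment> \<open>Signs of pairs that the reflection moves cancel in twos; only the pair on the line of \<open>a\<close> remains.\<close>
  also have "card ?N = card (?N - ?F) + card ?F"
  proof -
    have "?F \<subseteq> ?N" using nz pm_sign_minus by (auto simp: half_sphere_def)
    then show ?thesis using card_Diff_subset[of ?F ?N] card_mono[of ?N ?F] by simp
  qed
  also have "even (card (?N - ?F))"
  proof (rule even_card_involution[where h = ?f])
    fix v assume "v \<in> ?N - ?F"
    then have v: "v \<in> half_sphere c" "pm_sign (?r v) = - 1" "?r v \<noteq> - v" by auto
    have fv: "?f v = - ?r v" using v by (simp add: pm_rep_def)
    have rf: "?r (?f v) = - v" by (simp add: fv isometryD(5)[OF isometry_reflection])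
    have s: "pm_sign (?r (?f v)) = - 1" using v nz by (simp add: rf pm_sign_minus half_sphere_def)
    have "?f v \<in> half_sphere c"
      by (rule pm_rep_in_half_sphere)
         (use assms v in \<open>auto simp: isometryD(3)[OF isometry_reflection] half_sphere_def\<close>)
    moreover have "?r (?f v) \<noteq> - ?f v" using v(3) rf fv by (metis minus_minus)
    ultimately show "?f v \<in> ?N - ?F" using s by simp
    show "?f (?f v) = v" using s rf by (simp add: pm_rep_def)
    show "?f v \<noteq> v" using v(3) fv by (metis minus_minus)
  qed simp
  then have "(- 1 :: int) ^ (card (?N - ?F) + card ?F) = (- 1) ^ card ?F"
    by (simp add: power_add)
  also have "card ?F = (if is_square (c * Q a a) then 1 else 0)"
  proof -
    have line: "v = (Q v a / Q a a) *s a" if "?r v = - v" for v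
    proof -
      define k where "k = Q v a / Q a a"
      have eq: "v - (2 * k) *s a = - v" using that by (simp add: reflection_def k_def)
      have "v $ i = k * a $ i" for i
      proof -
        have "v $ i - 2 * k * a $ i = - v $ i" using arg_cong[OF eq, of "\<lambda>v. v $ i"] by simp
        then have "2 * (v $ i - k * a $ i) = 0" by (simp add: algebra_simps mult_2[of "v $ i"] eq_neg_iff_add_eq_0)
        then show ?thesis using two_nonzero by simp
      qed
      then show ?thesis by (simp add: vec_eq_iff k_def)
    qed
    have uniq: "v = w" if vw: "v \<in> ?F" "w \<in> ?F" for v w
    proof -
      obtain k l where kl: "v = k *s a" "w = l *s a" using vw line by blast
      then have "k^2 * Q a a = l^2 * Q a a"
        using vw by (simp add: half_sphere_def bilin power2_eq_square mult.assoc)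
      then have "k = l \<or> k = - l" using assms(2) by (simp add: power2_eq_iff)
      then have "v = w \<or> v = - w" using kl by auto
      then show ?thesis using half_sphere_pm[OF assms(1)] vw by auto
    qed
    show ?thesis
    proof (cases "is_square (c * Q a a)")
      case True
      then obtain k where k: "c * Q a a = k^2" by (auto simp: is_nth_power_def)
      define v where "v = (k / Q a a) *s a"
      have "Q v v = c" using k assms by (simp add: v_def bilin power2_eq_square field_simps)
      moreover have "?r (pm_rep v) = - pm_rep v"
        using reflection_self[OF assms(2)]
        by (simp add: pm_rep_def v_def isometryD[OF isometry_reflection] del: vec.scale_minus_left)
      ultimately have "pm_rep v \<in> ?F" using pm_rep_in_half_sphere[OF assms(1)] by auto
      then have "?F = {pm_rep v}" using uniq by blast
      then show ?thesis using True by simp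
    next
      case False
      have "?F = {}"
      proof (rule equals0I)
        fix v assume v: "v \<in> ?F"
        then obtain k where "v = k *s a" using line by blast
        then have "c = k^2 * Q a a" using v by (auto simp: half_sphere_def bilin power2_eq_square mult.assoc)
        then have "c * Q a a = (k * Q a a)^2" by (simp add: power2_eq_square)
        with False show False by auto
      qed
      then show ?thesis using False by simp
    qed
  qed
  finally show ?thesis by simp
qed

lemma transfer_refl_products:
  assumes "c \<noteq> 0" "g \<in> refl_products Q A" "\<And>a. a \<in> A \<Longrightarrow> Q a a \<noteq> 0 \<and> \<not> is_square (c * Q a a)"
  shows "transfer c g = 1"
  using assms(2,3)
proof (induction rule: refl_products.induct)
  case (step a g)
  have "transfer c (reflection Q a \<circ> g) = transfer c (reflection Q a) * transfer c g"
    by (rule transfer_comp[OF assms(1) isometry_reflection isometry_refl_products[OF step.hyps(2)]])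
  moreover have "transfer c (reflection Q a) = 1"
    using step.prems[OF step.hyps(1)] assms(1) by (simp add: transfer_reflection)
  moreover have "transfer c g = 1" using step.IH step.prems by blast
  ultimately show ?case by (simp only: mult_1_left)
qed simp


section \<open>Nonsingular subspaces\<close>

text \<open>
  By polarization, a subspace of isotropic vectors is totally isotropic.
\<close>

lemma nonisotropic_exists:
  assumes "vec.subspace W" "nonsingular Q W" "W \<noteq> {0}"
  shows "\<exists>e\<in>W. Q e e \<noteq> 0"
proof (rule ccontr)
  assume "\<not> ?thesis"
  then have iso: "Q e e = 0" if "e \<in> W" for e using that by auto
  have "x = 0" if "x \<in> W" for x
  proof (rule nonsingularD[OF assms(2) that])
    fix w assume "w \<in> W"
    then have "Q (x + w) (x + w) = 0" using that assms(1) iso vec.subspace_add by blast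
    then have "2 * Q x w = 0" using iso that \<open>w \<in> W\<close> by (simp add: bilin sym[of w x])
    then show "Q x w = 0" using two_nonzero by simp
  qed
  then show False using assms vec.subspace_0 by blast
qed

text \<open>
  Splitting off a nonisotropic vector is the induction step for nonsingular subspaces.
\<close>

lemma split_off:
  assumes W: "vec.subspace W" "nonsingular Q W" and e: "e \<in> W" "Q e e \<noteq> 0"
  defines "W' \<equiv> {x \<in> W. Q x e = 0}"
  shows "vec.subspace W'" "nonsingular Q W'" "vec.dim W = Suc (vec.dim W')"
    "\<And>x. x \<in> W \<Longrightarrow> x - (Q x e / Q e e) *s e \<in> W'"
proof -
  show sub: "vec.subspace W'"
    using W(1) unfolding W'_def vec.subspace_def by (auto simp: bilin)
  show proj: "x - (Q x e / Q e e) *s e \<in> W'" if "x \<in> W" for x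
    unfolding W'_def using that W e by (auto simp: bilin intro!: vec.subspace_diff vec.subspace_scale)
  show "nonsingular Q W'"
  proof (rule nonsingularI[OF sub])
    fix x assume x: "x \<in> W'" "\<And>w. w \<in> W' \<Longrightarrow> Q x w = 0"
    show "x = 0"
    proof (rule nonsingularD[OF W(2)])
      fix w assume "w \<in> W"
      then have "Q x (w - (Q w e / Q e e) *s e) = 0" using proj x by blast
      then show "Q x w = 0" using x(1) by (simp add: bilin W'_def)
    qed (use x in \<open>simp add: W'_def\<close>)
  qed
  have "vec.span (insert e W') = W"
  proof (rule vec.span_subspace)
    show "insert e W' \<subseteq> W" using e by (auto simp: W'_def)
    show "W \<subseteq> vec.span (insert e W')"
      using proj by (auto simp: vec.span_insert intro!: vec.span_base)
  qed (rule W(1))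
  moreover have "e \<notin> vec.span W'"
    using sub e by (simp add: vec.span_eq_iff[THEN iffD2]) (simp add: W'_def)
  ultimately show "vec.dim W = Suc (vec.dim W')"
    by (metis Suc_eq_plus1 vec.dim_insert vec.dim_span)
qed

lemma orthogonal_decomposition:
  assumes "vec.subspace W" "nonsingular Q W"
  shows "\<exists>w\<in>W. x - w \<in> perp Q W"
  using assms
proof (induction "vec.dim W" arbitrary: W rule: less_induct)
  case less
  show ?case
  proof (cases "W = {0}")
    case True
    then show ?thesis by (auto simp: perp_def)
  next
    case False
    then obtain e where e: "e \<in> W" "Q e e \<noteq> 0" using less.prems nonisotropic_exists by blast
    let ?W = "{x \<in> W. Q x e = 0}"
    note sp = split_off[OF less.prems e]
    obtain w where w: "w \<in> ?W" "x - w \<in> perp Q ?W"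
      using less.hyps[OF _ sp(1,2)] sp(3) by auto
    define k where "k = Q (x - w) e / Q e e"
    have "x - (w + k *s e) \<in> perp Q W" unfolding perp_def
    proof safe
      fix y assume y: "y \<in> W"
      let ?y = "y - (Q y e / Q e e) *s e"
      have "?y \<in> ?W" using sp(4)[OF y] .
      then have "Q (x - w) ?y = 0" "Q e ?y = 0" using w(2) sym[of e ?y] by (auto simp: perp_def)
      moreover have "Q (x - (w + k *s e)) e = 0" using e by (simp add: k_def bilin)
      moreover have "Q (x - (w + k *s e)) ?y = Q (x - w) ?y - k * Q e ?y"
        by (simp only: diff_left add_left scale_left) simp
      moreover have "Q z y = Q z ?y + (Q y e / Q e e) * Q z e" for z
        by (simp only: diff_right scale_right) simp
      ultimately show "Q (x - (w + k *s e)) y = 0" by simp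
    qed
    moreover have "w + k *s e \<in> W" using w e less.prems by (auto intro: vec.subspace_add vec.subspace_scale)
    ultimately show ?thesis by blast
  qed
qed

lemma perp_perp:
  assumes "vec.subspace W" "nonsingular Q W" "\<And>y. y \<in> perp Q W \<Longrightarrow> Q x y = 0"
  shows "x \<in> W"
proof -
  obtain w where w: "w \<in> W" "x - w \<in> perp Q W" using orthogonal_decomposition assms(1,2) by blast
  have "x - w = 0"
  proof (rule eq_zeroI)
    fix y
    obtain v where v: "v \<in> W" "y - v \<in> perp Q W" using orthogonal_decomposition assms(1,2) by blast
    have "Q (x - w) v = 0" using w(2) v(1) by (simp add: perp_def)
    moreover have "Q x (y - v) = 0" using assms(3) v by blast
    moreover have "Q w (y - v) = 0" using v(2) w(1) sym[of w "y - v"] by (simp add: perp_def)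
    ultimately show "Q (x - w) y = 0" by (simp add: bilin)
  qed
  with w show ?thesis by simp
qed

lemma isometry_eqI:
  assumes "vec.subspace W" "nonsingular Q W" "isometry g" "isometry h"
    and "\<And>x. x \<in> perp Q W \<Longrightarrow> g x = x" "\<And>x. x \<in> perp Q W \<Longrightarrow> h x = x"
    and "\<And>x. x \<in> W \<Longrightarrow> g x = h x"
  shows "g = h"
proof
  fix x
  obtain w where "w \<in> W" "x - w \<in> perp Q W" using orthogonal_decomposition assms(1,2) by blast
  then have "g (w + (x - w)) = h (w + (x - w))"
    unfolding isometryD(1)[OF assms(3)] isometryD(1)[OF assms(4)] using assms(5-7) by simp
  then show "g x = h x" by simp
qed

lemma isometry_preserves:
  assumes "vec.subspace W" "nonsingular Q W" "isometry g" "\<And>x. x \<in> perp Q W \<Longrightarrow> g x = x" "w \<in> W"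
  shows "g w \<in> W"
proof (rule perp_perp[OF assms(1,2)])
  fix y assume "y \<in> perp Q W"
  then show "Q (g w) y = 0"
    using isometryD(3)[OF assms(3), of w y] assms(4)[of y] assms(5) sym[of w y]
    by (simp add: perp_def)
qed

text \<open>
  The weak form of the theorem, without a bound on the number of reflections. For a nonisotropic
  \<open>e \<in> W\<close>, one of \<open>g e - e\<close> and \<open>g e + e\<close> is not isotropic; reflecting in it takes \<open>g e\<close> to \<open>e\<close> or
  to \<open>- e\<close>, and one more reflection corrects the sign. What remains fixes \<open>e\<close> and therefore belongs
  to the complement of \<open>e\<close> in \<open>W\<close>.
\<close>

theorem Cartan_Dieudonne:
  assumes "vec.subspace W" "nonsingular Q W" "isometry g" "\<And>x. x \<in> perp Q W \<Longrightarrow> g x = x"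
  shows "g \<in> refl_products Q {a \<in> W. Q a a \<noteq> 0}"
  using assms
proof (induction "vec.dim W" arbitrary: W g rule: less_induct)
  case less
  show ?case
  proof (cases "W = {0}")
    case True
    then have "g = id" using less.prems(4) by (auto simp: perp_def)
    then show ?thesis by (simp add: refl_products.id)
  next
    case False
    then obtain e where e: "e \<in> W" "Q e e \<noteq> 0" using less.prems nonisotropic_exists by blast
    let ?W = "{x \<in> W. Q x e = 0}"
    let ?R = "refl_products Q {a \<in> W. Q a a \<noteq> 0}"
    note sp = split_off[OF less.prems(1,2) e]
    have stab: "h \<in> ?R" if h: "isometry h" "\<And>x. x \<in> perp Q W \<Longrightarrow> h x = x" "h e = e" for h
    proof -
      have "h \<in> refl_products Q {a \<in> ?W. Q a a \<noteq> 0}"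
      proof (rule less.hyps[OF _ sp(1,2) h(1)])
        show "vec.dim ?W < vec.dim W" using sp(3) by simp
        fix x assume x: "x \<in> perp Q ?W"
        let ?x = "x - (Q x e / Q e e) *s e"
        have "?x \<in> perp Q W" unfolding perp_def
        proof safe
          fix y assume "y \<in> W"
          then have "Q x (y - (Q y e / Q e e) *s e) = 0" using sp(4) x unfolding perp_def by blast
          then show "Q ?x y = 0" by (simp add: bilin sym[of e y])
        qed
        then have "h ?x = ?x" using h(2) by blast
        then show "h x = x" using isometryD[OF h(1)] h(3) by simp
      qed
      then show ?thesis using refl_products_mono[of "{a \<in> ?W. Q a a \<noteq> 0}" "{a \<in> W. Q a a \<noteq> 0}"] by blast
    qed
    have fixr: "reflection Q a x = x" if "a \<in> W" "x \<in> perp Q W" for a x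
      using that by (intro reflection_fixes) (auto simp: perp_def)
    \<comment> \<open>The norms of \<open>m\<close> and \<open>s\<close> add up to \<open>4 (e \<cdot> e)\<close>, so one of the two vectors is not isotropic.\<close>
    have ge: "g e \<in> W" using isometry_preserves[OF less.prems e(1)] .
    have gg: "Q (g e) (g e) = Q e e" by (rule isometryD(3)[OF less.prems(3)])
    define m where "m = g e - e"
    define s where "s = g e + e"
    have ms: "m \<in> W" "s \<in> W" using ge e less.prems(1) by (auto simp: m_def s_def intro: vec.subspace_diff vec.subspace_add)
    have Qm: "Q m m = 2 * (Q e e - Q (g e) e)" "Q s s = 2 * (Q e e + Q (g e) e)"
      using gg by (auto simp: m_def s_def bilin sym[of e "g e"] algebra_simps)
    have Qgm: "Q (g e) m = Q e e - Q (g e) e" "Q (g e) s = Q e e + Q (g e) e"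
      using gg by (auto simp: m_def s_def bilin)
    show ?thesis
    proof (cases "Q m m = 0")
      case False
      then have "Q e e - Q (g e) e \<noteq> 0" using Qm by auto
      then have "2 * (Q (g e) m / Q m m) = 1" using Qm Qgm two_nonzero by simp
      then have "reflection Q m (g e) = e" by (simp add: reflection_def) (simp add: m_def)
      then have "reflection Q m \<circ> g \<in> ?R"
        using less.prems fixr ms by (intro stab isometry_comp isometry_reflection) auto
      from refl_products.step[OF _ this, of m] have "reflection Q m \<circ> (reflection Q m \<circ> g) \<in> ?R"
        using ms False by blast
      then show ?thesis by simp
    next
      case True
      then have "Q e e = Q (g e) e" using Qm two_nonzero by simp
      then have eq: "Q s s = 2 * Q (g e) s" and "Q (g e) s = 2 * Q e e" using Qm Qgm by simp_all
      then have nz': "Q (g e) s \<noteq> 0" using e two_nonzero by simp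
      have nz: "Q s s \<noteq> 0" using nz' two_nonzero unfolding eq by simp
      have "2 * (Q (g e) s / Q s s) = 1" using nz' two_nonzero unfolding eq by simp
      then have "reflection Q s (g e) = - e" by (simp add: reflection_def) (simp add: s_def)
      then have "reflection Q e (reflection Q s (g e)) = e"
        using reflection_self[OF e(2)] isometryD(5)[OF isometry_reflection, of e e] by simp
      then have "reflection Q e \<circ> (reflection Q s \<circ> g) \<in> ?R"
        using less.prems fixr ms e by (intro stab isometry_comp isometry_reflection) auto
      from refl_products.step[OF _ refl_products.step[OF _ this, of e], of s]
      have "reflection Q s \<circ> (reflection Q e \<circ> (reflection Q e \<circ> (reflection Q s \<circ> g))) \<in> ?R"
        using ms nz e by blast
      then show ?thesis by simp
    qed
  qed
qed


section \<open>Three reflections in a plane\<close>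

text \<open>
  In the Clifford algebra, the product \<open>c a b\<close> of three vectors of a plane is again a vector of the
  plane, namely \<open>d = (c \<cdot> a) b - (c \<cdot> b) a + (a \<cdot> b) c\<close>, and norms multiply. So the product of the
  three reflections is the reflection in \<open>d\<close>. The identity is polynomial and holds in singular
  planes as well.
\<close>

lemma three_reflections_in_plane:
  assumes nz: "Q a a \<noteq> 0" "Q b b \<noteq> 0" "Q c c \<noteq> 0" and c: "c = x *s a + y *s b"
  defines "d \<equiv> (x * Q a a + 2 * y * Q a b) *s b - (y * Q b b) *s a"
  shows "Q d d = Q c c * Q a a * Q b b"
    and "reflection Q a \<circ> reflection Q b = reflection Q c \<circ> reflection Q d"
proof -
  have C: "Q c c = x^2 * Q a a + 2 * x * y * Q a b + y^2 * Q b b"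
    by (simp add: c bilin sym[of b a] power2_eq_square algebra_simps)
  show dd: "Q d d = Q c c * Q a a * Q b b"
    unfolding C d_def by (simp add: bilin sym[of b a] power2_eq_square algebra_simps)
  have "reflection Q c (reflection Q a (reflection Q b v)) = reflection Q d v" for v
  proof -
    let ?k = "2 * (Q v b / Q b b)"
    define A where "A = 2 * ((Q v a - ?k * Q a b) / Q a a)"
    define N where "N = x * (Q v a - ?k * Q a b - A * Q a a) + y * (Q v b - ?k * Q b b - A * Q a b)"
    define T where "T = (x * Q a a + 2 * y * Q a b) * Q v b - y * Q b b * Q v a"
    have co: "A + 2 * (N / Q c c) * x = - (2 * (T / (Q c c * Q a a * Q b b)) * (y * Q b b))"
      "?k + 2 * (N / Q c c) * y = 2 * (T / (Q c c * Q a a * Q b b)) * (x * Q a a + 2 * y * Q a b)"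
      unfolding A_def N_def T_def by (rule three_reflections_coefficients[OF nz C])+
    have 1: "reflection Q b v = v - ?k *s b" by (simp add: reflection_def)
    have 2: "reflection Q a (v - ?k *s b) = v - ?k *s b - A *s a"
      unfolding reflection_def A_def by (simp only: bilin sym[of b a])
    have 3: "Q (v - ?k *s b - A *s a) c = N"
      by (simp add: c N_def bilin sym[of b a] algebra_simps)
    have 4: "reflection Q c (v - ?k *s b - A *s a) =
        v - ?k *s b - A *s a - (2 * (N / Q c c)) *s (x *s a + y *s b)"
      unfolding reflection_def 3 by (simp add: c)
    have "Q v d = T" unfolding d_def T_def by (simp only: bilin)
    then have 5: "reflection Q d v = v - (2 * (T / (Q c c * Q a a * Q b b))) *s d"
      by (simp add: reflection_def dd)
    show ?thesis unfolding 1 2 4 5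
    proof (rule vec_eq_iff[THEN iffD2], rule allI)
      fix i
      define z where "z = 2 * (T / (Q c c * Q a a * Q b b))"
      have "(v - ?k *s b - A *s a - (2 * (N / Q c c)) *s (x *s a + y *s b)) $ i =
          v $ i - (?k + 2 * (N / Q c c) * y) * b $ i - (A + 2 * (N / Q c c) * x) * a $ i"
        by (simp add: algebra_simps)
      also have "\<dots> = v $ i - (z * (x * Q a a + 2 * y * Q a b)) * b $ i + (z * (y * Q b b)) * a $ i"
        unfolding co z_def by (simp only: mult_minus_left diff_minus_eq_add)
      also have "\<dots> = (v - z *s d) $ i"
        by (simp add: d_def algebra_simps)
      finally show "(v - ?k *s b - A *s a - (2 * (N / Q c c)) *s (x *s a + y *s b)) $ i =
          (v - (2 * (T / (Q c c * Q a a * Q b b))) *s d) $ i"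
        unfolding z_def .
    qed
  qed
  then have rd: "reflection Q d v = reflection Q c (reflection Q a (reflection Q b v))" for v by simp
  show "reflection Q a \<circ> reflection Q b = reflection Q c \<circ> reflection Q d"
    by (rule ext) (simp add: rd)
qed

section \<open>Pairs of reflections in vectors of nonsquare norm\<close>

text \<open>
  By the multiplicativity of the transfer, a product of two reflections in vectors of nonsquare
  norm looks like a product of reflections in vectors of square norm. The lemmas of this part
  decide when it really is one.
\<close>

abbreviation sq_vectors :: "('a ^ 'n) set \<Rightarrow> ('a ^ 'n) set" where
  "sq_vectors W \<equiv> {a \<in> W. Q a a \<noteq> 0 \<and> is_square (Q a a)}"

abbreviation nonsq_vectors :: "('a ^ 'n) set \<Rightarrow> ('a ^ 'n) set" where
  "nonsq_vectors W \<equiv> {a \<in> W. \<not> is_square (Q a a)}"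

lemma nonsq_nz: "\<not> is_square (Q a a) \<Longrightarrow> Q a a \<noteq> 0"
  by auto

text \<open>
  A nonsingular plane contains a vector \<open>c\<close> of norm 1. Then \<open>r\<^sub>a r\<^sub>b = r\<^sub>c r\<^sub>d\<close> where the norm of \<open>d\<close> is
  the product of two nonsquares, hence a square.
\<close>

lemma nonsquare_pair_nondegenerate:
  assumes W: "vec.subspace W" and ab: "a \<in> nonsq_vectors W" "b \<in> nonsq_vectors W"
    and nd: "Q a a * Q b b \<noteq> (Q a b)^2"
  shows "reflection Q a \<circ> reflection Q b \<in> refl_products Q (sq_vectors W)"
proof -
  have nz: "Q a a \<noteq> 0" "Q b b \<noteq> 0" using ab nonsq_nz by auto
  define \<beta> where "\<beta> = Q b b - (Q a b)^2 / Q a a"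
  have "\<beta> \<noteq> 0" using nd nz by (simp add: \<beta>_def field_simps)
  then obtain x y where xy: "Q a a * x^2 + \<beta> * y^2 = 1"
    using binary_form_universal[OF two_nonzero nz(1)] by blast
  \<comment> \<open>\<open>\<beta>\<close> is the norm of the component of \<open>b\<close> orthogonal to \<open>a\<close>, and \<open>c\<close> has coordinates \<open>x, y\<close> in this
    orthogonal basis.\<close>
  define z where "z = x - y * (Q a b / Q a a)"
  define c where "c = z *s a + y *s b"
  have "Q c c = z^2 * Q a a + 2 * z * y * Q a b + y^2 * Q b b"
    by (simp add: c_def bilin sym[of b a] power2_eq_square algebra_simps)
  also have "\<dots> = Q a a * x^2 + \<beta> * y^2"
    using nz by (simp add: z_def \<beta>_def power2_eq_square field_simps)
  finally have c1: "Q c c = 1" using xy by simp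
  define d where "d = (z * Q a a + 2 * y * Q a b) *s b - (y * Q b b) *s a"
  have cW: "c \<in> W" using W ab by (auto simp: c_def intro: vec.subspace_add vec.subspace_scale)
  have dW: "d \<in> W" unfolding d_def using W ab by (intro vec.subspace_diff vec.subspace_scale) auto
  have "Q c c \<noteq> 0" using c1 by simp
  note three = three_reflections_in_plane[OF nz this c_def, folded d_def]
  have "is_square (Q d d)" "Q d d \<noteq> 0"
    using nonsquare_mult_nonsquare[OF two_nonzero, of "Q a a" "Q b b"] ab nz by (auto simp: three(1) c1)
  then show ?thesis unfolding three(2)
    using cW dW c1 by (intro refl_products.step reflection_in_refl_products) auto
qed

text \<open>
  If \<open>a\<close> and \<open>b\<close> span a singular plane, a third vector \<open>f\<close> may lead around it:
  \<open>r\<^sub>a r\<^sub>b = (r\<^sub>a r\<^sub>f) (r\<^sub>f r\<^sub>b)\<close>.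
\<close>

lemma nonsquare_pair_chain:
  assumes W: "vec.subspace W" and ab: "a \<in> nonsq_vectors W" "b \<in> nonsq_vectors W" "f \<in> nonsq_vectors W"
    and nd: "Q a a * Q f f \<noteq> (Q a f)^2" "Q f f * Q b b \<noteq> (Q f b)^2"
  shows "reflection Q a \<circ> reflection Q b \<in> refl_products Q (sq_vectors W)"
proof -
  have "(reflection Q a \<circ> reflection Q f) \<circ> (reflection Q f \<circ> reflection Q b) \<in> refl_products Q (sq_vectors W)"
    by (intro refl_products_comp nonsquare_pair_nondegenerate W ab nd)
  then show ?thesis by (simp only: comp_assoc reflection_comp_self)
qed

text \<open>
  In a singular plane \<open>b\<close> can be rescaled so that \<open>b \<cdot> b = a \<cdot> b = a \<cdot> a\<close>. Then \<open>u = b - a\<close> is isotropic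
  and orthogonal to \<open>a\<close>.
\<close>

lemma degenerate_pair:
  assumes W: "vec.subspace W" "a \<in> W" "b \<in> W" and nz: "Q a a \<noteq> 0" "Q b b \<noteq> 0"
    and deg: "Q a a * Q b b = (Q a b)^2"
  obtains u where "u \<in> W" "Q u u = 0" "Q u a = 0" "reflection Q b = reflection Q (a + u)"
proof -
  have g: "Q a b \<noteq> 0" using deg nz by auto
  define k where "k = Q a a / Q a b"
  have "k \<noteq> 0" using g nz by (simp add: k_def)
  define u where "u = k *s b - a"
  have kb: "k * Q a b = Q a a" using g by (simp add: k_def)
  have "k * (k * Q b b) * Q a a = (k * Q a b) * (k * Q a b)"
  proof -
    have "k * (k * Q b b) * Q a a = k * k * (Q a a * Q b b)" by (simp only: mult_ac)
    then show ?thesis unfolding deg power2_eq_square by (simp only: mult_ac)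
  qed
  then have "k * (k * Q b b) * Q a a = Q a a * Q a a" unfolding kb .
  then have kk: "k * (k * Q b b) = Q a a" by (simp only: mult_right_cancel[OF nz(1)])
  have "u \<in> W" using W by (auto simp: u_def intro: vec.subspace_diff vec.subspace_scale)
  moreover have "Q u u = k * (k * Q b b) - k * Q a b - k * Q a b + Q a a"
    unfolding u_def bilin sym[of b a] by (simp only: algebra_simps)
  then have "Q u u = 0" unfolding kb kk by simp
  moreover have "Q u a = 0" by (simp add: u_def bilin sym[of b a] kb)
  moreover have "reflection Q b = reflection Q (a + u)"
    using reflection_scale[OF \<open>k \<noteq> 0\<close>, of b] by (simp add: u_def)
  ultimately show thesis using that by blast
qed

lemma hyperbolic_partner:
  assumes W: "vec.subspace W" "nonsingular Q W" and au: "a \<in> W" "u \<in> W" "Q a a \<noteq> 0"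
    and u: "u \<noteq> 0" "Q u u = 0" "Q u a = 0"
  obtains v where "v \<in> W" "Q u v = 1" "Q v v = 0" "Q v a = 0"
proof -
  obtain v0 where v0: "v0 \<in> W" "Q u v0 \<noteq> 0" using nonsingularD[OF W(2) au(2)] u(1) by blast
  define v1 where "v1 = (1 / Q u v0) *s (v0 - (Q v0 a / Q a a) *s a)"
  have v1: "v1 \<in> W" "Q v1 a = 0" "Q u v1 = 1"
    using v0 W au u by (auto simp: v1_def bilin intro!: vec.subspace_diff vec.subspace_scale)
  define v where "v = v1 - (Q v1 v1 / 2) *s u"
  have "v \<in> W" using v1 W au by (auto simp: v_def intro: vec.subspace_diff vec.subspace_scale)
  moreover have "Q u v = 1" "Q v a = 0" using v1 u by (auto simp: v_def bilin)
  moreover have "Q v v = 0"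
    using v1 u two_nonzero sym[of v1 u] by (simp add: v_def bilin field_simps)
  ultimately show thesis using that by blast
qed

lemma nonsquare_pair_char_ge_5:
  assumes W: "vec.subspace W" "nonsingular Q W" and ab: "a \<in> nonsq_vectors W" "b \<in> nonsq_vectors W"
    and three: "(3::'a) \<noteq> 0"
  shows "reflection Q a \<circ> reflection Q b \<in> refl_products Q (sq_vectors W)"
proof (cases "Q a a * Q b b = (Q a b)^2")
  case True
  have nz: "Q a a \<noteq> 0" "Q b b \<noteq> 0" using ab nonsq_nz by auto
  obtain u where u: "u \<in> W" "Q u u = 0" "Q u a = 0" "reflection Q b = reflection Q (a + u)"
    using degenerate_pair[OF W(1) _ _ nz True] ab by blast
  show ?thesis
  proof (cases "u = 0")
    case True
    then show ?thesis using u(4) by (simp only: add_0_right reflection_comp_self refl_products.id)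
  next
    case False
    obtain v where v: "v \<in> W" "Q u v = 1" "Q v v = 0" "Q v a = 0"
      using hyperbolic_partner[OF W _ u(1) nz(1) False u(2,3)] ab by blast
    let ?\<alpha> = "Q a a"
    \<comment> \<open>In the hyperbolic plane of \<open>u\<close> and \<open>v\<close>, orthogonal to \<open>a\<close>, the vector \<open>u + (2 t \<alpha>) v\<close> has norm
      \<open>4 t \<alpha>\<close>, a nonsquare for square \<open>t \<noteq> 0\<close>, and it spans a nondegenerate plane with \<open>a + u\<close> if
      \<open>t \<noteq> 1\<close>. The choice is \<open>t = 4\<close>, which differs from 1 outside characteristic three.\<close>
    define f where "f = u + (8 * ?\<alpha>) *s v"
    have au: "Q (a + u) (a + u) = ?\<alpha>" using u sym[of a u] by (simp add: bilin)
    have ff: "Q f f = 4^2 * ?\<alpha>" using u v sym[of v u] by (simp add: f_def bilin)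
    have af: "Q a f = 0" using u v sym[of a u] sym[of a v] by (simp add: f_def bilin)
    have fb: "Q f (a + u) = 8 * ?\<alpha>" using u v sym[of v u] by (simp add: f_def bilin)
    have "(2::'a) * 2 \<noteq> 0" using two_nonzero by (intro no_zero_divisors)
    then have four: "(4::'a) \<noteq> 0" by simp
    then have sixteen: "(4::'a)^2 \<noteq> 0" by (rule power_not_zero)
    have nsq: "\<not> is_square (4^2 * ?\<alpha>)"
    proof
      assume "is_square (4^2 * ?\<alpha>)"
      then have "is_square (?\<alpha> * 4^2)" by (simp only: mult.commute)
      then have "is_square ?\<alpha>" using sixteen by (rule is_square_cancel[OF _ is_nth_power_nth_power])
      with ab(1) show False by simp
    qed
    have W': "a + u \<in> W" "f \<in> W"
      using W(1) ab u v by (auto simp: f_def intro: vec.subspace_add vec.subspace_scale)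
    have "reflection Q a \<circ> reflection Q (a + u) \<in> refl_products Q (sq_vectors W)"
    proof (rule nonsquare_pair_chain[OF W(1)])
      show "f \<in> nonsq_vectors W" using W' ff nsq by simp
      show "a + u \<in> nonsq_vectors W" using W' au ab by simp
      show "?\<alpha> * Q f f \<noteq> (Q a f)^2" using nz sixteen by (simp add: ff af)
      have "Q f f * Q (a + u) (a + u) - (Q f (a + u))^2 = - (4 * 4 * 3 * ?\<alpha> * ?\<alpha>)"
        unfolding ff fb au by (simp add: power2_eq_square algebra_simps)
      also have "\<dots> \<noteq> 0" using four three nz by (simp only: neg_equal_0_iff_equal mult_eq_0_iff) simp
      finally show "Q f f * Q (a + u) (a + u) \<noteq> (Q f (a + u))^2" by simp
    qed (use ab in auto)
    then show ?thesis using u(4) by simp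
  qed
qed (use nonsquare_pair_nondegenerate[OF W(1) ab] in simp)

section \<open>Stabilizers inside the group of square reflections\<close>

text \<open>
  The reflections in vectors of square norm generate a normal subgroup. If products of pairs of
  the other reflections belong to it as well, its index is at most two.
\<close>

lemma refl_products_modulo_square_reflections:
  assumes W: "vec.subspace W" and UW: "U \<subseteq> W"
    and pairs: "\<And>a b. a \<in> nonsq_vectors U \<Longrightarrow> b \<in> nonsq_vectors U \<Longrightarrow>
      reflection Q a \<circ> reflection Q b \<in> refl_products Q (sq_vectors W)"
    and g: "g \<in> refl_products Q {a \<in> U. Q a a \<noteq> 0}"
  shows "g \<in> refl_products Q (sq_vectors W) \<or>
    (\<exists>a\<in>nonsq_vectors U. reflection Q a \<circ> g \<in> refl_products Q (sq_vectors W))"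
  using g
proof (induction rule: refl_products.induct)
  case (step c g)
  let ?K = "refl_products Q (sq_vectors W)"
  show ?case
  proof (cases "is_square (Q c c)")
    case True
    then have c: "c \<in> sq_vectors W" using step.hyps UW by auto
    from step.IH show ?thesis
    proof
      assume "g \<in> ?K"
      then show ?thesis using c by (blast intro: refl_products.step)
    next
      assume "\<exists>a\<in>nonsq_vectors U. reflection Q a \<circ> g \<in> ?K"
      then obtain a where a: "a \<in> nonsq_vectors U" "reflection Q a \<circ> g \<in> ?K" by blast
      let ?c = "reflection Q a c"
      have "?c \<in> sq_vectors W"
        using c a UW reflection_in_subspace[OF W] isometryD(3)[OF isometry_reflection] by auto
      then have "reflection Q ?c \<circ> (reflection Q a \<circ> g) \<in> ?K" using a by (blast intro: refl_products.step)
      also have "reflection Q ?c \<circ> (reflection Q a \<circ> g) = reflection Q a \<circ> (reflection Q c \<circ> g)"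
        using conjugate_reflection[OF isometry_reflection] by (auto simp: fun_eq_iff)
      finally show ?thesis using a(1) by blast
    qed
  next
    case False
    then have c: "c \<in> nonsq_vectors U" using step.hyps by auto
    from step.IH show ?thesis
    proof
      assume "g \<in> ?K"
      then have "reflection Q c \<circ> (reflection Q c \<circ> g) \<in> ?K" by (simp only: reflection_comp_self)
      then show ?thesis using c by blast
    next
      assume "\<exists>a\<in>nonsq_vectors U. reflection Q a \<circ> g \<in> ?K"
      then obtain a where a: "a \<in> nonsq_vectors U" "reflection Q a \<circ> g \<in> ?K" by blast
      then have "(reflection Q c \<circ> reflection Q a) \<circ> (reflection Q a \<circ> g) \<in> ?K"
        using pairs[OF c a(1)] by (blast intro: refl_products_comp)
      then have "reflection Q c \<circ> g \<in> ?K" by (simp only: comp_assoc reflection_comp_self)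
      then show ?thesis by blast
    qed
  qed
next
  case id
  show ?case using refl_products.id by blast
qed

text \<open>
  By the theorem of Cartan and Dieudonne, \<open>g\<close> is a product of reflections in vectors of \<open>U\<close>. Either
  it is a product of square reflections in \<open>W\<close>, or it becomes one after multiplication by a single
  nonsquare reflection. The transfer for a nonsquare \<open>c\<close> excludes the second case, as it is trivial
  on every product of square reflections, in \<open>W\<close> or in the whole space.
\<close>

lemma stabilizer_in_square_reflections:
  assumes W: "vec.subspace W" and U: "vec.subspace U" "nonsingular Q U" "U \<subseteq> W"
    and pairs: "\<And>a b. a \<in> nonsq_vectors U \<Longrightarrow> b \<in> nonsq_vectors U \<Longrightarrow>
      reflection Q a \<circ> reflection Q b \<in> refl_products Q (sq_vectors W)"
    and g: "g \<in> refl_products Q (sq_vectors UNIV)" "\<And>x. x \<in> perp Q U \<Longrightarrow> g x = x"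
  shows "g \<in> refl_products Q (sq_vectors W)"
proof (rule ccontr)
  assume not: "g \<notin> refl_products Q (sq_vectors W)"
  have iso: "isometry g" using g(1) by (rule isometry_refl_products)
  obtain a where a: "\<not> is_square (Q a a)" and ag: "reflection Q a \<circ> g \<in> refl_products Q (sq_vectors W)"
    using refl_products_modulo_square_reflections[OF W U(3) pairs Cartan_Dieudonne[OF U(1,2) iso g(2)]] not
    by auto
  have nz: "Q a a \<noteq> 0" using a by auto
  have ns: "Q x x \<noteq> 0 \<and> \<not> is_square (Q a a * Q x x)" if x: "x \<in> sq_vectors S" for x S
  proof -
    show ?thesis using a x is_square_cancel[of "Q a a" "Q x x"] by blast
  qed
  have "transfer (Q a a) g = 1" by (rule transfer_refl_products[OF nz g(1) ns])
  moreover have "transfer (Q a a) (reflection Q a \<circ> g) = 1" by (rule transfer_refl_products[OF nz ag ns])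
  moreover have "transfer (Q a a) (reflection Q a \<circ> g) = transfer (Q a a) (reflection Q a) * transfer (Q a a) g"
    by (rule transfer_comp[OF nz isometry_reflection iso])
  moreover have "transfer (Q a a) (reflection Q a) = - 1"
    using transfer_reflection[OF nz nz] nonsquare_mult_nonsquare[OF two_nonzero a a] by simp
  ultimately show False by simp
qed

lemma square_reflection_not_in_nonsquare_products:
  assumes "Q e e \<noteq> 0" "is_square (Q e e)"
  shows "reflection Q e \<notin> refl_products Q (nonsq_vectors W)"
proof
  assume "reflection Q e \<in> refl_products Q (nonsq_vectors W)"
  then have "transfer 1 (reflection Q e) = 1" by (rule transfer_refl_products[rotated]) auto
  then show False using transfer_reflection[of 1 e] assms by simp
qed

lemma nonsquare_reflection_not_in_square_products:
  assumes "\<not> is_square (Q e e)"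
  shows "reflection Q e \<notin> refl_products Q (sq_vectors W)"
proof
  let ?c = "Q e e"
  have nz: "?c \<noteq> 0" using assms by auto
  assume "reflection Q e \<in> refl_products Q (sq_vectors W)"
  then have "transfer ?c (reflection Q e) = 1"
  proof (rule transfer_refl_products[OF nz])
    fix x assume x: "x \<in> sq_vectors W"
    then show "Q x x \<noteq> 0 \<and> \<not> is_square (?c * Q x x)"
      using assms is_square_cancel[of ?c "Q x x"] by blast
  qed
  then show False using transfer_reflection[OF nz nz] nonsquare_mult_nonsquare[OF two_nonzero assms assms] by simp
qed


section \<open>Groups acting on a subspace\<close>

text \<open>
  Orthogonal groups of a subspace \<open>W\<close> consist of maps that are undefined outside \<open>W\<close>. The following
  lemmas translate them into products of reflections on the whole space, which restrict faithfully
  to a nonsingular \<open>W\<close> when the reflecting vectors lie in \<open>W\<close>.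
\<close>

lemma restrict_in_Bij:
  assumes "isometry g" "g ` W \<subseteq> W"
  shows "restrict g W \<in> Bij W"
proof -
  have "inj_on g W" using isometry_inj[OF assms(1)] by (rule inj_on_subset) simp
  then have "bij_betw g W W" using endo_inj_surj[OF _ assms(2)] by (simp add: bij_betw_def)
  then have "bij_betw (restrict g W) W W" by (simp cong: bij_betw_cong)
  then show ?thesis by (simp add: Bij_def)
qed

lemma restrict_mult:
  assumes "isometry g" "g ` W \<subseteq> W" "isometry h" "h ` W \<subseteq> W"
  shows "restrict g W \<otimes>\<^bsub>BijGroup W\<^esub> restrict h W = restrict (g \<circ> h) W"
  using restrict_in_Bij[OF assms(1,2)] restrict_in_Bij[OF assms(3,4)] assms
  by (auto simp: BijGroup_def compose_def fun_eq_iff)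

lemma reflection_image: "vec.subspace W \<Longrightarrow> a \<in> W \<Longrightarrow> reflection Q a ` W \<subseteq> W"
  using reflection_in_subspace by blast

lemma refl_products_image:
  "g \<in> refl_products Q A \<Longrightarrow> A \<subseteq> W \<Longrightarrow> vec.subspace W \<Longrightarrow> g ` W \<subseteq> W"
  using refl_products_in_subspace by blast

lemma restrict_one: "\<one>\<^bsub>BijGroup W\<^esub> = restrict id W"
  by (auto simp: BijGroup_def fun_eq_iff)

lemma restrict_reflection_inv:
  assumes "vec.subspace W" "a \<in> W"
  shows "inv\<^bsub>BijGroup W\<^esub> (restrict (reflection Q a) W) = restrict (reflection Q a) W"
proof (rule group.inv_equality[OF group_BijGroup])
  show "restrict (reflection Q a) W \<otimes>\<^bsub>BijGroup W\<^esub> restrict (reflection Q a) W = \<one>\<^bsub>BijGroup W\<^esub>"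
    using restrict_mult[OF isometry_reflection reflection_image isometry_reflection reflection_image] assms
    by (simp only: reflection_comp_self restrict_one)
qed (use restrict_in_Bij[OF isometry_reflection reflection_image] assms in \<open>auto simp: BijGroup_def\<close>)

lemma generate_reflections:
  assumes W: "vec.subspace W" and A: "A \<subseteq> W"
  shows "generate (BijGroup W) ((\<lambda>a. restrict (reflection Q a) W) ` A) =
    (\<lambda>g. restrict g W) ` refl_products Q A" (is "?L = ?R")
proof (intro equalityI subsetI)
  have mult: "restrict g W \<otimes>\<^bsub>BijGroup W\<^esub> restrict h W = restrict (g \<circ> h) W"
    if "g \<in> refl_products Q A" "h \<in> refl_products Q A" for g h
    by (rule restrict_mult[OF isometry_refl_products[OF that(1)] refl_products_image[OF that(1) A W]
          isometry_refl_products[OF that(2)] refl_products_image[OF that(2) A W]])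
  fix f assume "f \<in> ?L"
  then show "f \<in> ?R"
  proof (induction rule: generate.induct)
    case one
    then show ?case unfolding restrict_one by (intro imageI refl_products.id)
  next
    case (incl h)
    then show ?case using reflection_in_refl_products by blast
  next
    case (inv h)
    then obtain a where a: "a \<in> A" "h = restrict (reflection Q a) W" by blast
    then have "inv\<^bsub>BijGroup W\<^esub> h = h" using restrict_reflection_inv[OF W, of a] A by blast
    with a show ?case using reflection_in_refl_products by blast
  next
    case (eng h1 h2)
    then obtain g1 g2 where "g1 \<in> refl_products Q A" "h1 = restrict g1 W"
      "g2 \<in> refl_products Q A" "h2 = restrict g2 W" by blast
    then have "h1 \<otimes>\<^bsub>BijGroup W\<^esub> h2 = restrict (g1 \<circ> g2) W" "g1 \<circ> g2 \<in> refl_products Q A"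
      using mult refl_products_comp by blast+
    then show ?case by blast
  qed
next
  fix f assume "f \<in> ?R"
  then obtain g where g: "g \<in> refl_products Q A" "f = restrict g W" by blast
  from g(1) have "restrict g W \<in> ?L"
  proof (induction rule: refl_products.induct)
    case id
    show ?case unfolding restrict_one[symmetric] by (rule generate.one)
  next
    case (step a g)
    have "restrict (reflection Q a) W \<otimes>\<^bsub>BijGroup W\<^esub> restrict g W \<in> ?L"
      by (rule generate.eng[OF generate.incl[OF imageI[OF step.hyps(1)]] step.IH])
    also have "restrict (reflection Q a) W \<otimes>\<^bsub>BijGroup W\<^esub> restrict g W = restrict (reflection Q a \<circ> g) W"
      using step A W by (intro restrict_mult isometry_reflection reflection_image isometry_refl_products[of g A]
          refl_products_image[of g A]) auto
    finally show ?case .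
  qed
  with g(2) show "f \<in> ?L" by simp
qed

lemma orth_group1_eq:
  "vec.subspace W \<Longrightarrow> orth_group1 Q W = (\<lambda>g. restrict g W) ` refl_products Q (sq_vectors W)"
  by (subst generate_reflections[symmetric])
     (auto simp: orth_group1_def intro!: arg_cong[where f = "generate (BijGroup W)"])

lemma orth_group2_eq:
  "vec.subspace W \<Longrightarrow> orth_group2 Q W = (\<lambda>g. restrict g W) ` refl_products Q (nonsq_vectors W)"
  by (subst generate_reflections[symmetric])
     (auto simp: orth_group2_def intro!: arg_cong[where f = "generate (BijGroup W)"])

lemma orth_group1_UNIV: "orth_group1 Q UNIV = refl_products Q (sq_vectors UNIV)"
proof -
  have "restrict g UNIV = g" for g :: "'a ^ 'n \<Rightarrow> 'a ^ 'n" by (simp add: restrict_def)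
  then show ?thesis by (simp add: orth_group1_eq)
qed

lemma generate_reflections_UNIV:
  "generate (BijGroup UNIV) (reflection Q ` A) = refl_products Q A"
proof -
  have "restrict g UNIV = g" for g :: "'a ^ 'n \<Rightarrow> 'a ^ 'n" by (simp add: restrict_def)
  then show ?thesis using generate_reflections[of UNIV A] by simp
qed

lemma restrict_in_orth_group:
  assumes "vec.subspace W" "isometry g" "g ` W \<subseteq> W"
  shows "restrict g W \<in> orth_group Q W"
  using restrict_in_Bij[OF assms(2,3)] assms(1)
  by (auto simp: orth_group_def isometryD[OF assms(2)] vec.subspace_add vec.subspace_scale)

lemma stabilizer_image:
  "vec.subspace W \<Longrightarrow> nonsingular Q W \<Longrightarrow> isometry g \<Longrightarrow> (\<And>x. x \<in> perp Q W \<Longrightarrow> g x = x) \<Longrightarrow> g ` W \<subseteq> W"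
  using isometry_preserves by blast

lemma stabilizer_eq_extension:
  assumes "vec.subspace W" "nonsingular Q W"
  shows "pointwise_stabilizer (orth_group Q UNIV) (perp Q W) = extend_by_id Q W (orth_group Q W)"
  using restrict_in_orth_group[OF assms(1) _ stabilizer_image[OF assms]]
  by (auto simp: pointwise_stabilizer_def extend_by_id_def orth_group_UNIV)

lemma eq_of_restrict_eq:
  assumes "vec.subspace W" "nonsingular Q W" "isometry g" "\<And>x. x \<in> perp Q W \<Longrightarrow> g x = x"
    and "h \<in> refl_products Q A" "A \<subseteq> W" "restrict g W = restrict h W"
  shows "g = h"
proof (rule isometry_eqI[OF assms(1-3) isometry_refl_products[OF assms(5)] assms(4)])
  show "h x = x" if "x \<in> perp Q W" for x using refl_products_fixes assms that by blast
  show "g x = h x" if "x \<in> W" for x using fun_cong[OF assms(7), of x] that by simp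
qed

lemma extension_of_orth_group1:
  assumes "vec.subspace W" "nonsingular Q W"
  shows "extend_by_id Q W (orth_group1 Q W) \<subseteq> pointwise_stabilizer (orth_group1 Q UNIV) (perp Q W)"
proof
  fix g assume "g \<in> extend_by_id Q W (orth_group1 Q W)"
  then have g: "isometry g" "\<And>x. x \<in> perp Q W \<Longrightarrow> g x = x"
    and "restrict g W \<in> (\<lambda>g. restrict g W) ` refl_products Q (sq_vectors W)"
    by (auto simp: extend_by_id_def orth_group_UNIV orth_group1_eq[OF assms(1)])
  then obtain h where h: "h \<in> refl_products Q (sq_vectors W)" "restrict g W = restrict h W" by blast
  have "g = h" by (rule eq_of_restrict_eq[OF assms g h(1) _ h(2)]) auto
  then have "g \<in> refl_products Q (sq_vectors UNIV)"
    using h(1) refl_products_mono[of "sq_vectors W" "sq_vectors UNIV"] by blast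
  with g(2) show "g \<in> pointwise_stabilizer (orth_group1 Q UNIV) (perp Q W)"
    by (auto simp: pointwise_stabilizer_def orth_group1_UNIV)
qed

lemma refl_products_eqI:
  assumes "vec.subspace W" "nonsingular Q W" "A \<subseteq> W" "A' \<subseteq> W"
    and "(\<lambda>g. restrict g W) ` refl_products Q A = (\<lambda>g. restrict g W) ` refl_products Q A'"
  shows "refl_products Q A = refl_products Q A'"
proof -
  have sub: "refl_products Q C \<subseteq> refl_products Q D"
    if CD: "C \<subseteq> W" "D \<subseteq> W"
      "(\<lambda>g. restrict g W) ` refl_products Q C = (\<lambda>g. restrict g W) ` refl_products Q D" for C D
  proof
    fix g assume g: "g \<in> refl_products Q C"
    then obtain h where h: "h \<in> refl_products Q D" "restrict g W = restrict h W" using CD(3) by blast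
    have "g = h"
      by (rule eq_of_restrict_eq[OF assms(1,2) isometry_refl_products[OF g] _ h(1) CD(2) h(2)])
         (rule refl_products_fixes[OF g CD(1)])
    with h show "g \<in> refl_products Q D" by simp
  qed
  show ?thesis using sub[OF assms(3-5)] sub[OF assms(4,3) assms(5)[symmetric]] by blast
qed

text \<open>
  A common element preserves both subspaces, hence \<open>U = W \<inter> W'\<close> and \<open>U\<^sup>\<bottom>\<close>; it moves every
  vector by an element of \<open>U\<close>, so on \<open>U\<^sup>\<bottom>\<close> it moves nothing.
\<close>

lemma common_element_fixes_perp:
  assumes W: "vec.subspace W" "vec.subspace W'" and A: "A \<subseteq> W" "A' \<subseteq> W'"
    and U: "U = W \<inter> W'" "nonsingular Q U"
    and g: "g \<in> refl_products Q A" "g \<in> refl_products Q A'" and x: "x \<in> perp Q U"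
  shows "g x = x"
proof -
  have iso: "isometry g" by (rule isometry_refl_products[OF g(1)])
  have img: "g ` U \<subseteq> U"
    using refl_products_image[OF g(1) A(1) W(1)] refl_products_image[OF g(2) A(2) W(2)] U by blast
  have "inj_on g U" using isometry_inj[OF iso] by (rule inj_on_subset) simp
  then have "g ` U = U" using endo_inj_surj[OF _ img] by simp
  have "g x - x \<in> U"
    using refl_products_displacement[OF g(1) A(1) W(1)] refl_products_displacement[OF g(2) A(2) W(2)] U by blast
  then have "g x - x = 0"
  proof (rule nonsingularD[OF U(2)])
    fix w assume w: "w \<in> U"
    then obtain v where v: "v \<in> U" "w = g v" using \<open>g ` U = U\<close> by blast
    have "Q (g x) (g v) = 0" using isometryD(3)[OF iso, of x v] x v by (simp add: perp_def)
    then show "Q (g x - x) w = 0" using x w v by (simp add: diff_left perp_def)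
  qed
  then show ?thesis by simp
qed

text \<open>
  If the group on \<open>W\<close> is the full orthogonal group there is nothing to prove, and if it consists of
  products of nonsquare reflections it cannot contain the square reflection \<open>r\<^sub>e\<close>. In the remaining
  case the hypothesis on pairs is available.
\<close>

theorem stabilizer_in_orthogonal_type:
  assumes W: "vec.subspace W" "nonsingular Q W" and U: "vec.subspace U" "nonsingular Q U" "U \<subseteq> W"
    and A: "A \<subseteq> W" and e: "e \<in> A" "Q e e \<noteq> 0" "is_square (Q e e)"
    and type: "(\<lambda>g. restrict g W) ` refl_products Q A \<in> {orth_group Q W, orth_group1 Q W, orth_group2 Q W}"
    and pairs: "\<And>a b. refl_products Q A = refl_products Q (sq_vectors W) \<Longrightarrow>
      a \<in> nonsq_vectors U \<Longrightarrow> b \<in> nonsq_vectors U \<Longrightarrow>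
      reflection Q a \<circ> reflection Q b \<in> refl_products Q (sq_vectors W)"
    and g: "g \<in> refl_products Q (sq_vectors UNIV)" "\<And>x. x \<in> perp Q U \<Longrightarrow> g x = x"
  shows "g \<in> refl_products Q A"
proof -
  have iso: "isometry g" by (rule isometry_refl_products[OF g(1)])
  have fixes_perp: "g x = x" if "x \<in> perp Q W" for x
    using g(2) that U(3) by (auto simp: perp_def)
  from type consider "(\<lambda>g. restrict g W) ` refl_products Q A = orth_group Q W"
    | "refl_products Q A = refl_products Q (sq_vectors W)"
    | "refl_products Q A = refl_products Q (nonsq_vectors W)"
    using refl_products_eqI[OF W A, of "sq_vectors W"] refl_products_eqI[OF W A, of "nonsq_vectors W"]
    by (auto simp: orth_group1_eq[OF W(1)] orth_group2_eq[OF W(1)])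
  then show ?thesis
  proof cases
    case 1
    have "restrict g W \<in> orth_group Q W"
      by (rule restrict_in_orth_group[OF W(1) iso stabilizer_image[OF W iso fixes_perp]])
    then obtain h where h: "h \<in> refl_products Q A" "restrict g W = restrict h W" using 1 by blast
    have "g = h" by (rule eq_of_restrict_eq[OF W iso fixes_perp h(1) A h(2)])
    with h show ?thesis by simp
  next
    case 2
    then show ?thesis using stabilizer_in_square_reflections[OF W(1) U pairs[OF 2] g] by simp
  next
    case 3
    then have "reflection Q e \<in> refl_products Q (nonsq_vectors W)"
      using reflection_in_refl_products[OF e(1)] by blast
    with square_reflection_not_in_nonsquare_products[OF e(2,3)] show ?thesis by blast
  qed
qed

end

section \<open>The field with three elements\<close>

text \<open>
  Over the field with three elements the only nonzero square is 1, and singular planes are harder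
  to avoid. In dimension at least five there is enough room. In dimension four the statement about
  pairs fails for the space of Witt index two; there the shape of the Coxeter group is used
  instead, to show that it does not contain all square reflections.
\<close>

locale quadratic_space_F3 = quadratic_space +
  assumes F3: "(x::'a) = 0 \<or> x = 1 \<or> x = - 1"
begin

lemma two_eq: "(2::'a) = - 1"
proof -
  have "(2::'a) \<noteq> 1"
  proof
    assume "(2::'a) = 1"
    then have "(1::'a) + 1 = 1 + 0" by (simp only: one_add_one add_0_right)
    then have "(1::'a) = 0" by (rule add_left_imp_eq)
    then show False by simp
  qed
  then show ?thesis using F3[of 2] two_nonzero by blast
qed

lemma one_plus_one: "(1::'a) + 1 = - 1"
  using two_eq by simp

lemma one_neq_minus: "(1::'a) \<noteq> - 1"
proof
  assume "(1::'a) = - 1"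
  then have "(1::'a) + 1 = 0" by (simp only: eq_neg_iff_add_eq_0)
  with two_nonzero show False by simp
qed

lemma F3_square: "(x::'a)^2 = 0 \<or> x^2 = 1"
  using F3[of x] by auto

lemma F3_sum_squares: "(x::'a)^2 + y^2 = 0 \<Longrightarrow> x = 0 \<and> y = 0"
proof -
  assume sum: "x^2 + y^2 = 0"
  have "x^2 \<noteq> 1"
  proof
    assume "x^2 = 1"
    then have "y^2 = - 1" using sum by (simp add: eq_neg_iff_add_eq_0 add.commute)
    then show False using F3_square[of y] one_neq_minus by (metis neg_equal_0_iff_equal zero_neq_one)
  qed
  then have "x^2 = 0" using F3_square[of x] by blast
  then show ?thesis using sum by simp
qed

lemma nonsquare_F3: "\<not> is_square (x::'a) \<longleftrightarrow> x = - 1"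
proof
  show "x = - 1" if "\<not> is_square x" using F3[of x] that by auto
  show "\<not> is_square x" if "x = - 1"
  proof
    assume "is_square x"
    then obtain y where "x = y^2" by (auto simp: is_nth_power_def)
    then have "y^2 = - 1" using that by blast
    then show False using F3_square[of y] one_neq_minus by (metis neg_equal_0_iff_equal zero_neq_one)
  qed
qed

text \<open>
  The sum of two orthogonal vectors of norm 1 has norm \<open>2 = - 1\<close>.
\<close>

lemma norm_minus_one_exists:
  assumes X: "vec.subspace X" "nonsingular Q X" "vec.dim X \<ge> 2"
  shows "\<exists>f\<in>X. Q f f = - 1"
proof -
  have "X \<noteq> {0}"
  proof
    assume "X = {0}"
    then show False using X(3) vec.dim_singleton[of 0] by simp
  qed
  then obtain x where x: "x \<in> X" "Q x x \<noteq> 0" using nonisotropic_exists[OF X(1,2)] by blast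
  note sp = split_off[OF X(1,2) x]
  have "{y \<in> X. Q y x = 0} \<noteq> {0}"
  proof
    assume eq: "{y \<in> X. Q y x = 0} = {0}"
    show False using sp(3) X(3) vec.dim_singleton[of 0] unfolding eq by simp
  qed
  then obtain y where y: "y \<in> X" "Q y x = 0" "Q y y \<noteq> 0" using nonisotropic_exists[OF sp(1,2)] by blast
  consider "Q x x = - 1" | "Q y y = - 1" | "Q x x = 1" "Q y y = 1" using F3[of "Q x x"] F3[of "Q y y"] x y by blast
  then show ?thesis
  proof cases
    case 3
    then have "Q (x + y) (x + y) = - 1" using y sym[of x y] two_eq by (simp add: bilin)
    then show ?thesis using x y X(1) vec.subspace_add by blast
  qed (use x y in auto)
qed

text \<open>
  The vectors \<open>a\<close>, \<open>u + v\<close> and \<open>u - v\<close>, with \<open>v\<close> a hyperbolic partner of \<open>u\<close>, are orthogonal and not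
  isotropic, and can be split off one after another. In particular \<open>W\<close> has dimension at least three.
\<close>

lemma hyperbolic_complement:
  assumes W: "vec.subspace W" "nonsingular Q W" and au: "a \<in> W" "u \<in> W" "Q a a \<noteq> 0"
    and u: "u \<noteq> 0" "Q u u = 0" "Q u a = 0"
  obtains X where "vec.subspace X" "nonsingular Q X" "vec.dim W = vec.dim X + 3" "X \<subseteq> W"
    "\<And>x. x \<in> X \<Longrightarrow> Q x a = 0 \<and> Q x u = 0"
proof -
  obtain v where v: "v \<in> W" "Q u v = 1" "Q v v = 0" "Q v a = 0"
    using hyperbolic_partner[OF W au u] by blast
  have p: "Q (u + v) (u + v) = 2" "Q (u - v) (u - v) = - 2" "Q (u - v) (u + v) = 0"
    using u v sym[of v u] by (auto simp: bilin)
  let ?X1 = "{x \<in> W. Q x a = 0}"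
  note s1 = split_off[OF W au(1,3)]
  have m1: "u + v \<in> ?X1" "u - v \<in> ?X1"
    using W(1) au u v by (auto simp: bilin intro: vec.subspace_add vec.subspace_diff)
  have n1: "Q (u + v) (u + v) \<noteq> 0" using p two_nonzero by simp
  let ?X2 = "{x \<in> ?X1. Q x (u + v) = 0}"
  note s2 = split_off[OF s1(1,2) m1(1) n1]
  have m2: "u - v \<in> ?X2" using m1 p by simp
  have n2: "Q (u - v) (u - v) \<noteq> 0" using p two_nonzero by simp
  note s3 = split_off[OF s2(1,2) m2 n2]
  let ?X3 = "{x \<in> ?X2. Q x (u - v) = 0}"
  have xu: "Q x u = 0" if "x \<in> ?X3" for x
  proof -
    have "2 * Q x u = Q x (u + v) + Q x (u - v)" by (simp add: bilin)
    also have "\<dots> = 0" using that by simp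
    finally show ?thesis using two_nonzero by simp
  qed
  have dims: "vec.dim W = vec.dim ?X3 + 3" using s1(3) s2(3) s3(3) by linarith
  show thesis
  proof (rule that[OF s3(1,2) dims])
    show "?X3 \<subseteq> W" by blast
    show "Q x a = 0 \<and> Q x u = 0" if "x \<in> ?X3" for x using xu[OF that] that by blast
  qed
qed

text \<open>
  A vector of norm \<open>- 1\<close> that is orthogonal to both vectors of a singular pair spans nonsingular
  planes with them. The complement \<open>X\<close> of the hyperbolic plane and \<open>a\<close> has dimension at least two
  and contains such a vector.
\<close>

lemma nonsquare_pair_F3:
  assumes W: "vec.subspace W" "nonsingular Q W" "vec.dim W \<ge> 5"
    and ab: "a \<in> nonsq_vectors W" "b \<in> nonsq_vectors W"
  shows "reflection Q a \<circ> reflection Q b \<in> refl_products Q (sq_vectors W)"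
proof (cases "Q a a * Q b b = (Q a b)^2")
  case True
  have nz: "Q a a \<noteq> 0" "Q b b \<noteq> 0" using ab nonsq_nz by auto
  obtain u where u: "u \<in> W" "Q u u = 0" "Q u a = 0" "reflection Q b = reflection Q (a + u)"
    using degenerate_pair[OF W(1) _ _ nz True] ab by blast
  show ?thesis
  proof (cases "u = 0")
    case True
    then show ?thesis using u(4) by (simp only: add_0_right reflection_comp_self refl_products.id)
  next
    case False
    obtain X where X: "vec.subspace X" "nonsingular Q X" "vec.dim W = vec.dim X + 3" "X \<subseteq> W"
      and orth: "\<And>x. x \<in> X \<Longrightarrow> Q x a = 0 \<and> Q x u = 0"
      using hyperbolic_complement[OF W(1,2) _ u(1) nz(1) False u(2,3)] ab by blast
    obtain f where f: "f \<in> X" "Q f f = - 1" using norm_minus_one_exists[OF X(1,2)] X(3) W(3) by auto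
    have au: "Q (a + u) (a + u) = Q a a" using u sym[of a u] by (simp add: bilin)
    have "reflection Q a \<circ> reflection Q (a + u) \<in> refl_products Q (sq_vectors W)"
    proof (rule nonsquare_pair_chain[OF W(1) ab(1)])
      show "f \<in> nonsq_vectors W" using f X(4) nonsquare_F3 by auto
      show "a + u \<in> nonsq_vectors W" using au ab u W(1) by (auto intro: vec.subspace_add)
      show "Q a a * Q f f \<noteq> (Q a f)^2" using nz f orth sym[of a f] by simp
      show "Q f f * Q (a + u) (a + u) \<noteq> (Q f (a + u))^2"
        using nz f orth by (simp add: au) (simp add: bilin)
    qed
    then show ?thesis using u(4) by simp
  qed
qed (use nonsquare_pair_nondegenerate[OF W(1) ab] in simp)

text \<open>
  For the form \<open>x\<^sup>2 + y\<^sup>2 - z\<^sup>2\<close>, the complement of a vector of norm \<open>- 1\<close> is anisotropic.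
\<close>

lemma no_isotropic_orthogonal:
  fixes x1 x2 x3 y1 y2 y3 :: 'a
  assumes "x1^2 + x2^2 - x3^2 = - 1" "y1^2 + y2^2 - y3^2 = 0" "x1 * y1 + x2 * y2 - x3 * y3 = 0"
  shows "y1 = 0 \<and> y2 = 0 \<and> y3 = 0"
proof (cases "x3 = 0")
  case True
  then have "x1^2 + x2^2 = - 1" using assms(1) by simp
  then have sq: "x1^2 = 1" "x2^2 = 1"
    using F3_square[of x1] F3_square[of x2] one_neq_minus by auto
  have "x1 * y1 = - (x2 * y2)" using assms(3) True by (simp add: eq_neg_iff_add_eq_0)
  then have "(x1 * y1)^2 = (x2 * y2)^2" by simp
  then have "y1^2 = y2^2" by (simp add: power_mult_distrib sq)
  then have "2 * y1^2 = y3^2" using assms(2) by simp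
  then have "y3^2 = - (y1^2)" unfolding two_eq by simp
  then have "y1^2 + y3^2 = 0" by simp
  then have "y1 = 0" "y3 = 0" using F3_sum_squares by blast+
  then show ?thesis using \<open>y1^2 = y2^2\<close> by simp
next
  case False
  then have "x3^2 = 1" using F3_square[of x3] by simp
  then have "x1^2 + x2^2 = 0" using assms(1) by simp
  then have "x1 = 0" "x2 = 0" using F3_sum_squares by blast+
  then have "y3 = 0" using assms(3) False by simp
  then show ?thesis using F3_sum_squares[of y1 y2] assms(2) by simp
qed

lemma span_3:
  "a \<in> vec.span {e1, e2, e3} \<Longrightarrow> \<exists>x y z. a = x *s e1 + y *s e2 + z *s e3"
proof -
  assume "a \<in> vec.span {e1, e2, e3}"
  then obtain x y z where "a - x *s e1 - y *s e2 - z *s e3 = 0"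
    by (auto simp: vec.span_breakdown_eq)
  then have "a = x *s e1 + y *s e2 + z *s e3" by (simp add: algebra_simps)
  then show ?thesis by blast
qed

lemma orth_span: "(\<And>e. e \<in> E \<Longrightarrow> Q x e = 0) \<Longrightarrow> w \<in> vec.span E \<Longrightarrow> Q x w = 0"
proof -
  assume E: "\<And>e. e \<in> E \<Longrightarrow> Q x e = 0" and "w \<in> vec.span E"
  have "vec.subspace {w. Q x w = 0}" by (auto simp: vec.subspace_def bilin)
  then have "vec.span E \<subseteq> {w. Q x w = 0}" using E by (intro vec.span_minimal) auto
  then show ?thesis using \<open>w \<in> vec.span E\<close> by blast
qed

text \<open>
  Orthogonalizing gives the basis \<open>e1\<close>, \<open>e3\<close>, \<open>w = e2 - c e1 - d e3\<close> with norms 1, 1 and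
  \<open>1 - c\<^sup>2 - d\<^sup>2\<close>. If \<open>c\<close> and \<open>d\<close> do not both vanish, there are two cases. Either the last norm is 0;
  then \<open>w\<close> lies in the radical, so it is 0, and \<open>U\<close> is anisotropic. Or the last norm is \<open>- 1\<close>, and
  \<open>no_isotropic_orthogonal\<close> excludes \<open>u\<close>.
\<close>

lemma path_of_three_orthogonal:
  assumes U: "nonsingular Q U" "U = vec.span {e1, e2, e3}"
    and e: "Q e1 e1 = 1" "Q e2 e2 = 1" "Q e3 e3 = 1" "Q e1 e3 = 0"
    and au: "a \<in> U" "Q a a = - 1" "u \<in> U" "u \<noteq> 0" "Q u u = 0" "Q u a = 0"
  shows "Q e1 e2 = 0 \<and> Q e2 e3 = 0"
proof (rule ccontr)
  assume not: "\<not> ?thesis"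
  define c d where "c = Q e1 e2" and "d = Q e2 e3"
  have cd: "Q e1 e2 = c" "Q e2 e1 = c" "Q e2 e3 = d" "Q e3 e2 = d" "Q e3 e1 = 0"
    using sym e by (auto simp: c_def d_def)
  define w where "w = e2 - c *s e1 - d *s e3"
  have w: "Q w e1 = 0" "Q w e3 = 0" "Q e1 w = 0" "Q e3 w = 0" "Q w e2 = 1 - c^2 - d^2"
    by (auto simp: w_def bilin e cd power2_eq_square)
  then have ww: "Q w w = 1 - c^2 - d^2"
    unfolding w_def[of ] by (simp add: bilin e cd power2_eq_square algebra_simps)
  have coords: "\<exists>x y z. b = x *s e1 + y *s e3 + z *s w" if bU: "b \<in> U" for b
  proof -
    obtain x y z where b: "b = x *s e1 + y *s e2 + z *s e3" using span_3 bU U(2) by blast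
    have "b = (x + y * c) *s e1 + (z + y * d) *s e3 + y *s w"
      by (simp add: b w_def vec_eq_iff algebra_simps)
    then show ?thesis by blast
  qed
  obtain x1 x2 x3 where a: "a = x1 *s e1 + x2 *s e3 + x3 *s w" using coords au by blast
  obtain y1 y2 y3 where u: "u = y1 *s e1 + y2 *s e3 + y3 *s w" using coords au by blast
  have "c^2 = 1 \<or> d^2 = 1"
    using not F3_square[of c] F3_square[of d] unfolding c_def d_def by auto
  then have "Q w w = - 1 \<or> Q w w = 0"
    using F3_square[of c] F3_square[of d] unfolding ww by auto
  then show False
  proof
    assume m: "Q w w = - 1"
    have "x1^2 + x2^2 - x3^2 = - 1"
      using au(2) by (simp add: a bilin e cd w m power2_eq_square)
    moreover have "y1^2 + y2^2 - y3^2 = 0"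
      using au(5) by (simp add: u bilin e cd w m power2_eq_square)
    moreover have "x1 * y1 + x2 * y2 - x3 * y3 = 0"
      using au(6) by (simp add: a u bilin e cd w m mult.commute)
    ultimately have "y1 = 0 \<and> y2 = 0 \<and> y3 = 0" by (rule no_isotropic_orthogonal)
    then show False using u au(4) by simp
  next
    assume m: "Q w w = 0"
    have "w \<in> U" unfolding U(2) w_def by (intro vec.span_diff vec.span_scale vec.span_base) auto
    then have "w = 0"
    proof (rule nonsingularD[OF U(1)])
      fix v assume "v \<in> U"
      then show "Q w v = 0" unfolding U(2) by (rule orth_span[rotated]) (use w ww m in auto)
    qed
    then have "y1^2 + y2^2 = 0" using au(5) by (simp add: u bilin e cd power2_eq_square)
    then have "y1 = 0" "y2 = 0" using F3_sum_squares by blast+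
    then show False using au(4) \<open>w = 0\<close> unfolding u by simp
  qed
qed

lemma refl_products_frame:
  assumes "g \<in> refl_products Q A" "Q e e \<noteq> 0" "\<And>a. a \<in> A \<Longrightarrow> a = e \<or> Q e a = 0"
  shows "g e = e \<or> g e = - e"
  using assms
proof (induction rule: refl_products.induct)
  case (step a g)
  have "reflection Q a e = e \<or> reflection Q a e = - e"
    using step.prems(2)[OF step.hyps(1)] reflection_self[OF step.prems(1)] reflection_fixes by blast
  then show ?case
    using step.IH[OF step.prems] isometryD(5)[OF isometry_reflection, of a e] by auto
qed simp

text \<open>
  The hypotheses force \<open>e1\<close>, \<open>e2\<close>, \<open>e3\<close> to be orthogonal, and then \<open>e4\<close> is orthogonal to them as well,
  because otherwise \<open>W\<close> is singular. So the reflections in the four vectors preserve the frame up to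
  signs. But \<open>e1 + e2 + e3 + e4\<close> has norm \<open>4 = 1\<close>, and the reflection in it does not.
\<close>

lemma rank_4_not_all_square_reflections:
  assumes W: "nonsingular Q W" "W = vec.span {e1, e2, e3, e4}"
    and U: "nonsingular Q U" "U = vec.span {e1, e2, e3}" "e4 \<notin> U"
    and e: "Q e1 e1 = 1" "Q e2 e2 = 1" "Q e3 e3 = 1" "Q e4 e4 = 1" "Q e1 e3 = 0" "Q e4 e2 = 0"
    and e4: "Q e4 e1 = 0 \<or> Q e4 e3 = 0"
    and au: "a \<in> U" "Q a a = - 1" "u \<in> U" "u \<noteq> 0" "Q u u = 0" "Q u a = 0"
  shows "refl_products Q {e1, e2, e3, e4} \<noteq> refl_products Q (sq_vectors W)"
proof
  assume eq: "refl_products Q {e1, e2, e3, e4} = refl_products Q (sq_vectors W)"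
  have 12: "Q e1 e2 = 0" "Q e2 e3 = 0"
    using path_of_three_orthogonal[OF U(1,2) e(1-3,5) au] by auto
  have s: "Q e2 e1 = 0" "Q e3 e2 = 0" "Q e3 e1 = 0" "Q e2 e4 = 0" "Q e1 e4 = Q e4 e1" "Q e3 e4 = Q e4 e3"
    using 12 e sym by metis+
  define z where "z = e4 - Q e4 e1 *s e1 - Q e4 e3 *s e3"
  have "Q e4 e1 = 0 \<and> Q e4 e3 = 0"
  proof (rule ccontr)
    assume not: "\<not> ?thesis"
    have "Q z e4 = 0"
      using e4 not F3_square[of "Q e4 e1"] F3_square[of "Q e4 e3"]
      by (auto simp: z_def bilin s e power2_eq_square)
    moreover have "Q z e1 = 0" "Q z e2 = 0" "Q z e3 = 0" by (auto simp: z_def bilin s e 12)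
    ultimately have orth: "Q z w = 0" if "w \<in> W" for w
      using that unfolding W(2) by (rule_tac orth_span) auto
    have "z \<in> W" unfolding W(2) z_def by (intro vec.span_diff vec.span_scale vec.span_base) auto
    then have "z = 0" using nonsingularD[OF W(1)] orth by blast
    then have "e4 = Q e4 e1 *s e1 + Q e4 e3 *s e3" by (simp add: z_def algebra_simps)
    moreover have "Q e4 e1 *s e1 + Q e4 e3 *s e3 \<in> U"
      unfolding U(2) by (intro vec.span_add vec.span_scale vec.span_base) auto
    ultimately show False using U(3) by simp
  qed
  then have 4: "Q e4 e1 = 0" "Q e4 e3 = 0" "Q e1 e4 = 0" "Q e3 e4 = 0" using s by auto
  define t where "t = e1 + e2 + e3 + e4"
  have "Q t t = 1 + 1 + 1 + 1" by (simp add: t_def bilin 12 s 4 e del: one_add_one)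
  also have "\<dots> = 1" by (simp only: one_plus_one) simp
  finally have tt: "Q t t = 1" .
  have "t \<in> W" unfolding W(2) t_def by (intro vec.span_add vec.span_base) auto
  then have "reflection Q t \<in> refl_products Q {e1, e2, e3, e4}"
    unfolding eq using tt by (intro reflection_in_refl_products) auto
  then have "reflection Q t e1 = e1 \<or> reflection Q t e1 = - e1"
    by (rule refl_products_frame) (use e 12 4 in auto)
  then have "Q (reflection Q t e1) e2 = 0" using 12 by auto
  moreover have "Q (reflection Q t e1) e2 = - 2"
    unfolding reflection_def tt by (simp add: t_def bilin e 12 s 4)
  ultimately show False using two_nonzero by simp
qed

end


section \<open>Reduction modulo a prime\<close>

text \<open>
  Cross-multiplication of two fractions for the same number is an identity of integers, and it
  survives the passage to a field in which both denominators are invertible.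
\<close>

lemma reduce_fraction:
  assumes "(of_int d :: 'a::field) \<noteq> 0"
  shows "(reduce (of_int c / of_int d) :: 'a) = of_int c / of_int d"
  unfolding reduce_def
proof (rule the_equality)
  show "\<exists>c' d'. (of_int d' :: 'a) \<noteq> 0 \<and> (of_int c / of_int d :: real) = of_int c' / of_int d' \<and>
    (of_int c / of_int d :: 'a) = of_int c' / of_int d'"
    by (intro exI[of _ c] exI[of _ d] conjI assms refl)
next
  fix y :: 'a
  assume "\<exists>c' d'. (of_int d' :: 'a) \<noteq> 0 \<and> (of_int c / of_int d :: real) = of_int c' / of_int d' \<and>
    y = of_int c' / of_int d'"
  then obtain c' d' where *: "(of_int d' :: 'a) \<noteq> 0" "y = of_int c' / of_int d'"
    "(of_int c / of_int d :: real) = of_int c' / of_int d'" by (elim exE conjE) (rule that)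
  have "d \<noteq> 0" "d' \<noteq> 0" using assms * by auto
  with *(3) have "(of_int (c * d') :: real) = of_int (c' * d)" by (simp add: field_simps)
  then have "c * d' = c' * d" by (simp only: of_int_eq_iff)
  then have "(of_int (c * d') :: 'a) = of_int (c' * d)" by (simp only:)
  then have "(of_int c * of_int d' :: 'a) = of_int c' * of_int d" by (simp only: of_int_mult)
  then show "y = of_int c / of_int d" unfolding *(2) using *(1) assms by (simp add: frac_eq_eq)
qed

lemma reduce_of_int [simp]: "(reduce (of_int c) :: 'a::field) = of_int c"
  using reduce_fraction[of 1 c] by simp

lemma reduce_0 [simp]: "(reduce 0 :: 'a::field) = 0"
  using reduce_of_int[of 0] by simp

lemma reduced_form_axis:
  "reduced_form B b x (axis j (1::'a::field)) = (\<Sum>i\<in>UNIV. x $ i * reduce (B (b i) (b j)))"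
  by (simp add: reduced_form_def axis_def if_distrib cong: if_cong)

lemma reduced_form_axis_axis [simp]:
  "reduced_form B b (axis i 1) (axis j (1::'a::field)) = reduce (B (b i) (b j))"
  unfolding reduced_form_axis by (simp add: axis_def if_distrib if_distribR cong: if_cong)

lemma quadratic_space_reduced_form:
  assumes "\<And>x y. B x y = B y x" "(2::'a::{field,finite}) \<noteq> 0"
    "nonsingular (reduced_form B b :: 'a ^ 'n::finite \<Rightarrow> _) UNIV"
  shows "quadratic_space (reduced_form B b :: 'a ^ 'n \<Rightarrow> 'a ^ 'n \<Rightarrow> 'a)"
proof
  fix x y z :: "'a ^ 'n" and c :: 'a
  show "reduced_form B b (x + y) z = reduced_form B b x z + reduced_form B b y z"
    by (simp add: reduced_form_def distrib_right sum.distrib)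
  show "reduced_form B b (c *s x) z = c * reduced_form B b x z"
    by (simp add: reduced_form_def sum_distrib_left mult.assoc)
  show "reduced_form B b x y = reduced_form B b y x"
    unfolding reduced_form_def by (subst sum.swap) (simp add: assms(1)[of "b _" "b _"] mult_ac)
qed (use assms in auto)

text \<open>
  The matrix of the reflection has integral entries, so its reduction is computed entrywise. It is
  the reflection for the reduced form because the reduced label is nonzero.
\<close>

lemma reduced_reflection_eq:
  fixes b :: "'n::finite \<Rightarrow> real ^ 'n"
  assumes b: "inj b" "independent (range b)"
    and B: "\<And>i. B (b i) (b i) > 0" "\<And>i j. B (b i) (b j) = B (b j) (b i)"
    and int: "\<And>i j. 2 * (B (b i) (b j) / B (b i) (b i)) \<in> \<int>"
    and label: "B (b i) (b i) = of_int l" "(of_int l :: 'a::field) \<noteq> 0" and two: "(2::'a) \<noteq> 0"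
  shows "reduced_reflection B b i = reflection (reduced_form B b) (axis i (1::'a))"
proof
  fix x :: "'a ^ 'n"
  have "\<forall>j. \<exists>m::int. 2 * (B (b i) (b j) / B (b i) (b i)) = of_int m"
    using int by (metis Ints_cases)
  then obtain m :: "'n \<Rightarrow> int" where m: "\<And>j. 2 * (B (b i) (b j) / B (b i) (b i)) = of_int (m j)"
    by metis
  have entry: "basis_matrix b (reflection B (b i)) $ k $ j =
      of_int ((if k = j then 1 else 0) - (if k = i then m j else 0))" for k j
  proof -
    have sp: "b j \<in> span (range b)" "b i \<in> span (range b)" by (auto intro: span_base)
    have "reflection B (b i) (b j) = b j - of_int (m j) *\<^sub>R b i"
      using m[of j] B(2)[of j i] by (simp add: reflection_def scalar_mult_eq_scaleR)
    then have "basis_matrix b (reflection B (b i)) $ k $ j =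
        representation (range b) (b j) (b k) - of_int (m j) * representation (range b) (b i) (b k)"
      using sp by (simp add: basis_matrix_def real_vector.representation_diff[OF b(2)]
          real_vector.representation_scale[OF b(2)] span_scale)
    also have "\<dots> = (if k = j then 1 else 0) - of_int (m j) * (if k = i then 1 else 0)"
      using b(1) by (simp add: real_vector.representation_basis[OF b(2)] inj_eq)
    finally show ?thesis by simp
  qed
  have gram: "reduce (B (b j) (b i)) = (of_int (m j) * of_int l / 2 :: 'a)" for j
  proof -
    \<comment> \<open>Entries of the Gram matrix are half-integers, so they can be reduced because 2 is invertible.\<close>
    have eq: "B (b j) (b i) = of_int (m j * l) / of_int 2"
      using m[of j] label(1) B(1)[of i] B(2)[of i j] by (simp add: field_simps)
    have "(reduce (of_int (m j * l) / of_int 2) :: 'a) = of_int (m j * l) / of_int 2"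
      by (rule reduce_fraction) (use two in simp)
    then show ?thesis unfolding eq by simp
  qed
  have coeff: "2 * (reduced_form B b x (axis i 1) / reduced_form B b (axis i 1) (axis i 1)) =
      (\<Sum>j\<in>UNIV. of_int (m j) * x $ j)"
  proof -
    have "reduced_form B b (axis i 1) (axis i (1::'a)) = of_int l" by (simp add: label(1))
    moreover have "2 * reduced_form B b x (axis i 1) = (\<Sum>j\<in>UNIV. of_int (m j) * x $ j) * of_int l"
      unfolding reduced_form_axis gram sum_distrib_left sum_distrib_right
      by (rule sum.cong) (use two in auto)
    ultimately show ?thesis using label(2) by simp
  qed
  show "reduced_reflection B b i x = reflection (reduced_form B b) (axis i 1) x"
  proof (rule vec_eq_iff[THEN iffD2], rule allI)
    fix k
    have "reduced_reflection B b i x $ k =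
        (\<Sum>j\<in>UNIV. of_int ((if k = j then 1 else 0) - (if k = i then m j else 0)) * x $ j)"
      unfolding reduced_reflection_def matrix_vector_mult_def entry reduce_of_int by simp
    also have "\<dots> = (\<Sum>j\<in>UNIV. if k = j then x $ j else 0) - (\<Sum>j\<in>UNIV. if k = i then of_int (m j) * x $ j else 0)"
      unfolding sum_subtractf[symmetric] by (rule sum.cong) (auto simp: left_diff_distrib)
    also have "\<dots> = x $ k - (if k = i then \<Sum>j\<in>UNIV. of_int (m j) * x $ j else 0)"
      by simp
    also have "\<dots> = reflection (reduced_form B b) (axis i 1) x $ k"
      unfolding reflection_def coeff by (simp add: axis_def)
    finally show "reduced_reflection B b i x $ k = reflection (reduced_form B b) (axis i 1) x $ k" .
  qed
qed

lemma node_bij: "bij_betw node {..<CARD('n::finite)} (UNIV :: 'n set)"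
  unfolding node_def by (rule bij_betw_from_nat_into_finite) simp

lemma node_eq_iff: "i < CARD('n::finite) \<Longrightarrow> j < CARD('n) \<Longrightarrow> (node i :: 'n) = node j \<longleftrightarrow> i = j"
  using bij_betw_imp_inj_on[OF node_bij] by (auto dest: inj_onD)

lemma node_surj: "\<exists>i<CARD('n::finite). k = (node i :: 'n)"
  using bij_betw_imp_surj_on[OF node_bij] by (metis UNIV_I imageE lessThan_iff)

lemma mem_coord_subspace: "x \<in> coord_subspace J \<longleftrightarrow> (\<forall>j\<in>J. x $ j = 0)"
proof
  assume "x \<in> coord_subspace J"
  moreover have "coord_subspace J \<subseteq> {x. \<forall>j\<in>J. x $ j = 0}"
    unfolding coord_subspace_def
    by (rule vec.span_minimal) (auto simp: axis_def vec.subspace_def)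
  ultimately show "\<forall>j\<in>J. x $ j = 0" by blast
next
  assume x: "\<forall>j\<in>J. x $ j = 0"
  have "x = (\<Sum>j\<in>UNIV. x $ j *s axis j 1)" by (simp add: basis_expansion)
  also have "\<dots> \<in> coord_subspace J"
    unfolding coord_subspace_def
  proof (rule vec.span_sum)
    fix j
    show "x $ j *s axis j 1 \<in> vec.span ((\<lambda>j. axis j 1) ` (- J))"
      using x by (cases "j \<in> J") (auto intro: vec.span_scale vec.span_base simp: vec.span_zero)
  qed
  finally show "x \<in> coord_subspace J" .
qed

lemma subspace_coord_subspace [simp]: "vec.subspace (coord_subspace J)"
  by (simp add: coord_subspace_def)

lemma axis_in_coord_subspace: "j \<notin> J \<Longrightarrow> axis j 1 \<in> coord_subspace J"
  by (auto simp: mem_coord_subspace axis_def)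

lemma dim_coord_subspace: "vec.dim (coord_subspace J :: ('a::field ^ 'n::finite) set) = card (- J)"
proof -
  let ?A = "(\<lambda>j. axis j (1::'a)) ` (- J) :: ('a ^ 'n) set"
  have "?A \<subseteq> cart_basis" by (auto simp: cart_basis_def)
  then have "vec.independent ?A" using independent_cart_basis vec.independent_mono by blast
  moreover have "card ?A = card (- J)" by (rule card_image) (auto simp: inj_on_def axis_eq_axis)
  ultimately show ?thesis by (simp add: coord_subspace_def vec.dim_span_eq_card_independent del: vec.dim_span)
qed

lemma mod_ring_3_cases:
  assumes "CARD('p::prime_card) = 3"
  shows "(x :: 'p mod_ring) = 0 \<or> x = 1 \<or> x = - 1"
proof -
  obtain i where i: "i < CARD('p)" "x = of_nat i" using surj_of_nat_mod_ring by blast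
  have "(of_nat 3 :: 'p mod_ring) = 0" using of_nat_card_eq_0[where 'a = 'p] assms by simp
  then have "(of_nat 2 :: 'p mod_ring) + 1 = 0" by simp
  then have "(of_nat 2 :: 'p mod_ring) = - 1" by (simp only: eq_neg_iff_add_eq_0)
  moreover have "i = 0 \<or> i = 1 \<or> i = 2" using i assms by auto
  ultimately show ?thesis using i by auto
qed

text \<open>
  The only possible prime divisors of a label are 2 and 3, and 3 occurs only together with a
  branch marked 6, which a generic prime 3 does not allow.
\<close>

lemma label_nonzero:
  assumes labels: "admissible_labels B b mark"
    and generic: "generic_prime CARD('p::prime_card) CARD('n::finite) mark"
  shows "\<exists>l::int. B (b k) (b (k::'n)) = of_int l \<and> (of_int l :: 'p mod_ring) \<noteq> 0"
proof -
  obtain i where i: "i < CARD('n)" "k = node i" using node_surj by blast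
  obtain l :: nat where l: "l > 0" "B (b k) (b k) = real l" "\<And>q. prime q \<Longrightarrow> q dvd l \<Longrightarrow> q = 2 \<or> q = 3"
    "3 dvd l \<Longrightarrow> \<exists>k\<in>{1..<CARD('n)}. mark k = 6"
    using labels i unfolding admissible_labels_def by blast
  have "\<not> CARD('p) dvd l"
    using l(3)[of "CARD('p)"] l(4) generic by (auto simp: generic_prime_def)
  then have "(of_nat l :: 'p mod_ring) \<noteq> 0" using of_nat_0_mod_ring_dvd by blast
  then show ?thesis using l(2) by (intro exI[of _ "int l"]) simp
qed


section \<open>The intersection of the two groups\<close>

theorem theorem3p2:
  fixes B :: "real ^ 'n \<Rightarrow> real ^ 'n \<Rightarrow> real"
    and b :: "'n::finite \<Rightarrow> real ^ 'n"
    and mark :: "nat \<Rightarrow> enat"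
    and Q :: "'p::prime_card mod_ring ^ 'n \<Rightarrow> 'p mod_ring ^ 'n \<Rightarrow> 'p mod_ring"
    and G0 Gn :: "('p mod_ring ^ 'n \<Rightarrow> 'p mod_ring ^ 'n) set"
    and V V0 Vn V0n :: "('p mod_ring ^ 'n) set"
  defines "Q \<equiv> reduced_form B b"
    and "G0 \<equiv> reduced_group B b {node 0}"
    and "Gn \<equiv> reduced_group B b {node (CARD('n) - 1)}"
    and "V \<equiv> UNIV"
    and "V0 \<equiv> coord_subspace {node 0}"
    and "Vn \<equiv> coord_subspace {node (CARD('n) - 1)}"
    and "V0n \<equiv> coord_subspace {node 0, node (CARD('n) - 1)}"
  assumes "basic_system B b mark"
    and "admissible_labels B b mark"
    and "CARD('n) \<ge> 3"
    and "generic_prime CARD('p) CARD('n) mark"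
    and "nonsingular Q V" and "nonsingular Q V0" and "nonsingular Q Vn" and "nonsingular Q V0n"
    and "orthogonal_type Q V0 G0" and "orthogonal_type Q Vn Gn"
    and "\<exists>i\<in>{1..CARD('n) - 2}. is_square (reduce (B (b (node i)) (b (node i))) :: 'p mod_ring)"
  shows
    "(\<forall>g\<in>G0 \<inter> Gn. \<forall>x\<in>perp Q V0n. g x = x) \<and>
     extend_by_id Q V0n (orth_group1 Q V0n) \<subseteq> pointwise_stabilizer (orth_group1 Q V) (perp Q V0n) \<and>
     pointwise_stabilizer (orth_group1 Q V) (perp Q V0n) \<subseteq> G0 \<inter> Gn \<and>
     G0 \<inter> Gn \<subseteq> pointwise_stabilizer (orth_group Q V) (perp Q V0n) \<and>
     pointwise_stabilizer (orth_group Q V) (perp Q V0n) = extend_by_id Q V0n (orth_group Q V0n) \<and>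
     (G0 = pointwise_stabilizer (orth_group Q V) (perp Q V0) \<and>
      Gn = pointwise_stabilizer (orth_group Q V) (perp Q Vn) \<longrightarrow>
        G0 \<inter> Gn = pointwise_stabilizer (orth_group Q V) (perp Q V0n))"
proof -
  note basic = assms(8) and labels = assms(9) and rank = assms(10) and generic = assms(11)
    and ns = assms(12-15) and type = assms(16,17) and square = assms(18)
  have B: "inj b" "independent (range b)" "\<And>x y. B x y = B y x" "\<And>i. B (b i) (b i) > 0"
    "\<And>i j. 2 * (B (b i) (b j) / B (b i) (b i)) \<in> \<int>"
    "\<And>i j. i < CARD('n) \<Longrightarrow> j < CARD('n) \<Longrightarrow> i + 2 \<le> j \<Longrightarrow> B (b (node i)) (b (node j)) = 0"
    using basic unfolding basic_system_def by auto
  have two: "(2 :: 'p mod_ring) \<noteq> 0"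
  proof
    assume "(2 :: 'p mod_ring) = 0"
    then have "CARD('p) dvd 2" using of_nat_0_mod_ring_dvd[of 2, where 'a = 'p] by simp
    then show False using generic dvd_imp_le[of "CARD('p)" 2] by (auto simp: generic_prime_def)
  qed
  interpret quadratic_space Q
    unfolding Q_def by (rule quadratic_space_reduced_form[OF B(3) two ns(1)[unfolded Q_def V_def]])
  let ?e = "\<lambda>i::nat. axis (node i) 1 :: 'p mod_ring ^ 'n"
  define last where "last = CARD('n) - 1"
  let ?A = "\<lambda>j. (\<lambda>k. axis k (1 :: 'p mod_ring)) ` (- {node j :: 'n}) :: ('p mod_ring ^ 'n) set"
  let ?V = "\<lambda>j. coord_subspace {node j :: 'n} :: ('p mod_ring ^ 'n) set"
  have label: "Q (axis k 1) (axis k 1) \<noteq> 0" for k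
  proof -
    obtain l where l: "B (b k) (b k) = of_int l" "(of_int l :: 'p mod_ring) \<noteq> 0"
      using label_nonzero[OF labels generic, of k] by (elim exE conjE) (rule that)
    have "Q (axis k 1) (axis k 1) = of_int l"
      unfolding Q_def reduced_form_axis_axis l(1) reduce_of_int ..
    with l(2) show ?thesis by (simp only: not_False_eq_True)
  qed
  have reflections: "reduced_reflection B b k = reflection Q (axis k 1)" for k
  proof -
    obtain l where l: "B (b k) (b k) = of_int l" "(of_int l :: 'p mod_ring) \<noteq> 0"
      using label_nonzero[OF labels generic, of k] by (elim exE conjE) (rule that)
    show ?thesis unfolding Q_def by (rule reduced_reflection_eq[where l = l]) (rule B l two)+
  qed
  have group: "reduced_group B b {node j} = refl_products Q (?A j)" for j
    unfolding reduced_group_def reflections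
    by (subst generate_reflections_UNIV[symmetric]) (simp add: image_image)
  have G: "G0 = refl_products Q (?A 0)" "Gn = refl_products Q (?A last)"
    unfolding G0_def Gn_def last_def by (rule group)+
  have sub: "vec.subspace V0" "vec.subspace Vn" "vec.subspace V0n"
    unfolding V0_def Vn_def V0n_def by simp_all
  have A: "?A j \<subseteq> ?V j" for j by (auto intro: axis_in_coord_subspace)
  have A': "?A 0 \<subseteq> V0" "?A last \<subseteq> Vn" using A by (auto simp: V0_def Vn_def last_def)
  have inter: "V0n = V0 \<inter> Vn" by (auto simp: V0_def Vn_def V0n_def mem_coord_subspace)
  have fixes_perp: "g x = x" if "g \<in> G0 \<inter> Gn" "x \<in> perp Q V0n" for g x
    using common_element_fixes_perp[OF sub(1,2) A' inter ns(4)] that unfolding G by blast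
  have isom: "isometry g" if "g \<in> G0" for g
    using that isometry_refl_products unfolding G by blast

  obtain s where s: "s \<in> {1..CARD('n) - 2}" "is_square (reduce (B (b (node s)) (b (node s))) :: 'p mod_ring)"
    using square by blast
  have sq: "Q (?e s) (?e s) \<noteq> 0" "is_square (Q (?e s) (?e s))"
    using label s(2) unfolding Q_def reduced_form_axis_axis by blast+
  have snode: "?e s \<in> ?A j" if "j = 0 \<or> j = last" for j
    using that s(1) rank node_eq_iff[of s j, where 'n = 'n] by (auto simp: last_def)

  \<comment> \<open>The hypothesis on pairs that the case of square reflections needs, for both end nodes \<open>j\<close> at once.\<close>
  have pairs: "reflection Q a \<circ> reflection Q a' \<in> refl_products Q (sq_vectors (?V j))"
    if j: "j = 0 \<or> j = last" and nsj: "nonsingular Q (?V j)"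
      and K: "refl_products Q (?A j) = refl_products Q (sq_vectors (?V j))"
      and aa: "a \<in> nonsq_vectors V0n" "a' \<in> nonsq_vectors V0n" for j a a'
  proof -
    have sub': "V0n \<subseteq> ?V j" using j inter by (auto simp: V0_def Vn_def last_def)
    then have aj: "a \<in> nonsq_vectors (?V j)" "a' \<in> nonsq_vectors (?V j)" using aa by auto
    show ?thesis
    proof (cases "CARD('p) = 3")
      case False
      have "(3 :: 'p mod_ring) \<noteq> 0"
      proof
        assume "(3 :: 'p mod_ring) = 0"
        then have "CARD('p) dvd 3" using of_nat_0_mod_ring_dvd[of 3, where 'a = 'p] by simp
        then show False using False generic dvd_imp_le[of "CARD('p)" 3] by (auto simp: generic_prime_def)
      qed
      then show ?thesis by (rule nonsquare_pair_char_ge_5[OF subspace_coord_subspace nsj aj])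
    next
      case True
      interpret quadratic_space_F3 Q by standard (rule mod_ring_3_cases[OF True])
      have jn: "j < CARD('n)" "last < CARD('n)" "last \<noteq> 0" using j rank by (auto simp: last_def)
      have dimW: "vec.dim (?V j) = CARD('n) - 1"
        unfolding dim_coord_subspace Compl_eq_Diff_UNIV by (simp add: card_Diff_subset)
      show ?thesis
      proof (cases "CARD('n) \<ge> 6")
        case True
        then show ?thesis using nonsquare_pair_F3[OF subspace_coord_subspace nsj _ aj] dimW by simp
      next
        case False
        show ?thesis
        proof (cases "Q a a * Q a' a' = (Q a a')^2")
          case True
          have nz: "Q a a \<noteq> 0" "Q a' a' \<noteq> 0" using aa nonsq_nz by auto
          obtain u where u: "u \<in> V0n" "Q u u = 0" "Q u a = 0" "reflection Q a' = reflection Q (a + u)"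
            using degenerate_pair[OF sub(3) _ _ nz True] aa by blast
          show ?thesis
          proof (cases "u = 0")
            case True
            then show ?thesis using u(4) by (simp only: add_0_right reflection_comp_self refl_products.id)
          next
            case False
            \<comment> \<open>A singular plane in \<open>V0n\<close> that is not totally isotropic requires dimension three, so the
              rank is five, and the dimension of \<open>?V j\<close> is four. Here the diagram gives a contradiction.\<close>
            have aU: "a \<in> V0n" "Q a a = - 1" using aa nonsquare_F3 by blast+
            have "3 \<le> vec.dim V0n"
              by (rule hyperbolic_complement[OF sub(3) ns(4) aU(1) u(1) nz(1) False u(2,3)]) simp
            moreover have "vec.dim V0n = CARD('n) - 2"
            proof -
              have "(node 0 :: 'n) \<noteq> node last" using jn node_eq_iff[of 0 last, where 'n = 'n] by auto
              then have "card {node 0, node last :: 'n} = 2" by simp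
              then show ?thesis unfolding V0n_def last_def[symmetric]
                unfolding dim_coord_subspace Compl_eq_Diff_UNIV by (simp add: card_Diff_subset)
            qed
            ultimately have five: "CARD('n) = 5" using \<open>\<not> CARD('n) \<ge> 6\<close> by linarith
            then have last: "last = 4" by (simp add: last_def)
            \<comment> \<open>\<open>m\<close> is the end node opposite to \<open>j\<close>; its vector is orthogonal to two of the inner three.\<close>
            define m where "m = 4 - j"
            have m: "m = 0 \<or> m = 4" "m \<noteq> j" "m < 5" "j < 5" using j last by (auto simp: m_def)
            have compl: "- node ` J = (node ` ({..<5} - J) :: 'n set)" if "J \<subseteq> {..<5}" for J
            proof -
              have "node ` ({..<5} - J) = (node ` {..<5} :: 'n set) - node ` J"
                using bij_betw_imp_inj_on[OF node_bij[where 'n = 'n]] that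
                by (intro inj_on_image_set_diff[where C = "{..<5}"]) (auto simp: five)
              also have "(node ` {..<5} :: 'n set) = UNIV"
                using bij_betw_imp_surj_on[OF node_bij[where 'n = 'n]] five by simp
              finally show ?thesis by (simp only: Compl_eq_Diff_UNIV)
            qed
            have lt5: "{..<5} = {0, 1, 2, 3, 4 :: nat}" by auto
            have "{..<5} - {j} = {1, 2, 3, m}" using j last by (auto simp: m_def lt5)
            then have Aj: "?A j = {?e 1, ?e 2, ?e 3, ?e m}"
              using compl[of "{j}"] m by simp
            have "{..<5} - {0, 4} = {1, 2, 3 :: nat}" by (auto simp: lt5)
            then have A04: "(\<lambda>k. axis k (1 :: 'p mod_ring)) ` (- {node 0, node 4 :: 'n}) = {?e 1, ?e 2, ?e 3}"
              using compl[of "{0, 4}"] by simp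
            have W: "?V j = vec.span {?e 1, ?e 2, ?e 3, ?e m}"
              using Aj by (simp add: coord_subspace_def)
            have U: "V0n = vec.span {?e 1, ?e 2, ?e 3}"
              unfolding V0n_def using A04 last by (simp add: coord_subspace_def last_def)
            \<comment> \<open>The transfer shows that all reflections in the group of \<open>?V j\<close> have square norm, which is 1.\<close>
            have unit: "Q x x = 1" if xA: "x \<in> ?A j" for x
            proof -
              have refl: "reflection Q x \<in> refl_products Q (sq_vectors (?V j))"
                using reflection_in_refl_products[OF xA, of Q] unfolding K .
              have "is_square (Q x x)"
                by (rule ccontr) (rule notE[OF nonsquare_reflection_not_in_square_products refl])
              then have "Q x x \<noteq> - 1" using nonsquare_F3[of "Q x x"] by blast
              moreover obtain k where "x = axis k 1" using xA by blast
              then have "Q x x \<noteq> 0" using label[of k] by (simp only: not_False_eq_True)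
              ultimately show ?thesis using F3[of "Q x x"] by blast
            qed
            have far: "Q (?e i) (?e k) = 0" if "i + 2 \<le> k \<or> k + 2 \<le> i" "i < 5" "k < 5" for i k
            proof -
              have "B (b (node i)) (b (node k)) = 0"
                using that B(6)[of i k] B(6)[of k i] B(3)[of "b (node i)" "b (node k)"] five by auto
              then show ?thesis unfolding Q_def reduced_form_axis_axis by (simp only: reduce_0)
            qed
            have "?e m \<notin> V0n"
              using m last by (auto simp: V0n_def mem_coord_subspace axis_def last_def)
            then have "refl_products Q {?e 1, ?e 2, ?e 3, ?e m} \<noteq> refl_products Q (sq_vectors (?V j))"
            proof (rule rank_4_not_all_square_reflections[OF nsj W ns(4) U _ _ _ _ _ _ _ _ aU u(1) False u(2,3)])
              show "Q (?e 1) (?e 1) = 1" "Q (?e 2) (?e 2) = 1" "Q (?e 3) (?e 3) = 1" "Q (?e m) (?e m) = 1"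
                by (rule unit, unfold Aj, blast)+
              show "Q (?e 1) (?e 3) = 0" by (rule far) simp_all
              show "Q (?e m) (?e 2) = 0" by (rule far) (use m in auto)
              show "Q (?e m) (?e 1) = 0 \<or> Q (?e m) (?e 3) = 0"
                using m(1) far[of m 1] far[of m 3] by (elim disjE) simp_all
            qed
            then show ?thesis using K unfolding Aj by (rule notE)
          qed
        qed (use nonsquare_pair_nondegenerate[OF subspace_coord_subspace aj] in simp)
      qed
    qed
  qed

  have step: "g \<in> refl_products Q (?A j)"
    if j: "j = 0 \<or> j = last" and nsj: "nonsingular Q (?V j)" and tj: "orthogonal_type Q (?V j) (refl_products Q (?A j))"
      and g: "g \<in> refl_products Q (sq_vectors UNIV)" "\<And>x. x \<in> perp Q V0n \<Longrightarrow> g x = x" for j g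
  proof (rule stabilizer_in_orthogonal_type[OF subspace_coord_subspace nsj sub(3) ns(4) _ A snode[OF j] sq _ _ g])
    show "V0n \<subseteq> ?V j" using j inter by (auto simp: V0_def Vn_def last_def)
    show "(\<lambda>g. restrict g (?V j)) ` refl_products Q (?A j) \<in> {orth_group Q (?V j), orth_group1 Q (?V j), orth_group2 Q (?V j)}"
      using tj unfolding orthogonal_type_def Let_def by blast
  qed (use pairs[OF j nsj] in blast)
  have upper: "pointwise_stabilizer (orth_group1 Q V) (perp Q V0n) \<subseteq> G0 \<inter> Gn"
  proof
    fix g assume "g \<in> pointwise_stabilizer (orth_group1 Q V) (perp Q V0n)"
    then have g: "g \<in> refl_products Q (sq_vectors UNIV)" "\<And>x. x \<in> perp Q V0n \<Longrightarrow> g x = x"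
      by (auto simp: pointwise_stabilizer_def V_def orth_group1_UNIV)
    show "g \<in> G0 \<inter> Gn"
      using step[of 0, OF _ _ _ g] step[of last, OF _ _ _ g] ns(2,3) type
      unfolding G V0_def Vn_def last_def by simp
  qed
  have lower: "G0 \<inter> Gn \<subseteq> pointwise_stabilizer (orth_group Q V) (perp Q V0n)"
    using fixes_perp isom by (auto simp: pointwise_stabilizer_def V_def orth_group_UNIV)
  have "perp Q V0 \<subseteq> perp Q V0n" "perp Q Vn \<subseteq> perp Q V0n"
    using inter by (auto simp: perp_def)
  then have full: "pointwise_stabilizer (orth_group Q V) (perp Q V0n) \<subseteq>
      pointwise_stabilizer (orth_group Q V) (perp Q V0) \<inter> pointwise_stabilizer (orth_group Q V) (perp Q Vn)"
    by (auto simp: pointwise_stabilizer_def)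
  have "extend_by_id Q V0n (orth_group1 Q V0n) \<subseteq> pointwise_stabilizer (orth_group1 Q V) (perp Q V0n)"
    unfolding V_def by (rule extension_of_orth_group1[OF sub(3) ns(4)])
  moreover have "pointwise_stabilizer (orth_group Q V) (perp Q V0n) = extend_by_id Q V0n (orth_group Q V0n)"
    unfolding V_def by (rule stabilizer_eq_extension[OF sub(3) ns(4)])
  ultimately show ?thesis using fixes_perp upper lower full by blast
qed

end
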